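(* Let $m$ and $n$ be integers. (i) The fundamental group of the $(-2,2m+1,2n)$-pretzel link is isomorphic to the group $\langle a,w \mid r=\overleftarrow{r}\rangle$, where $r:=u^{n-1}awaw^{-1}a^{-1}$ and $u:=(awaw^{-1})^{1-m}w$. Hence its universal character ring is the quotient of the polynomial ring $\mathbb{C}[x,y,z]$ by the principal ideal generated by the polynomial $$P_{raw}-P_{\overleftarrow{r}aw}=(xyz+4-x^2-y^2-z^2)\bigl[(xz-y)S_{n-1}(\alpha)-(S_m(\beta)-S_{m-1}(\beta))S_{n-2}(\alpha)\bigr],$$ where $$\alpha:=P_u=yS_{m-1}(\beta)-(xz-y)S_{m-2}(\beta),\qquad \beta:=P_{awaw^{-1}}=xyz+2-y^2-z^2 .$$ (ii) The universal character ring of the $(-2,2m+1,2n)$-pretzel link is reduced (i.e. its nilradical is zero) for all integers $m$ and $n$.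
   Context: Pretzel link: the $(p_1,p_2,p_3)$-pretzel link in $S^3$ is the link with the standard diagram consisting of three vertical columns of twisted pairs of strands, with $p_1,p_2,p_3$ signed crossings (half twists) respectively, adjacent columns being joined cyclically at the top and at the bottom. "Fundamental group of the link" means the fundamental group of its complement in $S^3$, and "universal character ring of the link" means that of this group. For the $(-2,2m+1,2n)$-pretzel link this group, in terms of suitable meridians $a,b,c$, is the group used in the paper: $$\pi=\langle a,b,c \mid bab^{-1}=(ac)^{-m}c(ac)^m,\ a^{-1}ba=(cb)^nb(cb)^{-n}\rangle.$$ (The letter $a$ in the two-generator presentation in the claim corresponds to the meridian $a$.) Chebyshev polynomials: $S_0(\gamma)=1$, $S_1(\gamma)=\gamma$, $S_{k+1}(\gamma)=\gamma S_k(\gamma)-S_{k-1}(\gamma)$ for all integers $k$ (including negative $k$, so $S_{-1}=0$, $S_{-2}=-1$). $F_{a,w}=\langle a,w\rangle$ is the free group on two letters. For a word $u$ in $a^{\pm1},w^{\pm1}$, $\overleftarrow{u}$ is the word with the letters of $u$ (with their exponents) written in reversed order; this is well defined on $F_{a,w}$ as the anti-automorphism fixing $a$ and $w$. Trace polynomials: for every $u\in F_{a,w}$ there is a unique polynomial $P_u\in\mathbb{C}[x,y,z]$ such that for every representation $\rho:F_{a,w}\to SL_2(\mathbb{C})$ one has $\operatorname{tr}\rho(u)=P_u(\operatorname{tr}\rho(a),\operatorname{tr}\rho(w),\operatorname{tr}\rho(aw))$. Thus $x=P_a$, $y=P_w$, $z=P_{aw}$. Universal character ring: for a finitely presented group $G$,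 choose $g_1,\dots,g_k\in G$ such that for every $g\in G$ there is a polynomial $P_g$ in $k$ variables with $\operatorname{tr}\rho(g)=P_g(x_1,\dots,x_k)$, $x_j=\operatorname{tr}\rho(g_j)$, for all representations $\rho:G\to SL_2(\mathbb{C})$; the universal character ring is the quotient of $\mathbb{C}[x_1,\dots,x_k]$ by the ideal generated by all expressions $\operatorname{tr}\rho(u)-\operatorname{tr}\rho(v)$ where $u,v$ are words in $g_1,\dots,g_k$ which are equal in $G$. It does not depend on the choice of the $g_j$ and depends only on $G$ up to isomorphism. For a group $G$ generated by two elements $a,w$ (a quotient of $F_{a,w}$), using $a,w,aw$, this is concretely $\mathbb{C}[x,y,z]/J$, where $J$ is the ideal generated by all $P_u-P_v$ with $u,v\in F_{a,w}$ having the same image in $G$. *)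

theory Defs
  imports
    "HOL-Analysis.Analysis"
    "HOL-Algebra.Algebra"
    "HOL-Algebra.Algebraic_Closure_Type"
begin

section \<open>Words and group presentations\<close>

text \<open>The letter \<open>(g, True)\<close> stands for the generator \<open>g\<close>, and \<open>(g, False)\<close> for its inverse.
  The reversed word (letters in opposite order, exponents kept) is \<^const>\<open>rev\<close>, in contrast to
  the inverse word below.\<close>

type_synonym 'g word = "('g \<times> bool) list"

definition inv_word :: "'g word \<Rightarrow> 'g word" where
  "inv_word u = rev (map (\<lambda>(g, e). (g, \<not> e)) u)"

definition word_pow :: "'g word \<Rightarrow> int \<Rightarrow> 'g word" where
  "word_pow u k =
     (if k \<ge> 0 then concat (replicate (nat k) u) else concat (replicate (nat (- k)) (inv_word u)))"

text \<open>\<open>word_eq R\<close> is the congruence on words whose quotient is the group with all elements of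
  \<^typ>\<open>'g\<close> as generators and the defining relations \<open>l = r\<close> for \<open>(l, r) \<in> R\<close>.\<close>

inductive word_eq :: "('g word \<times> 'g word) set \<Rightarrow> 'g word \<Rightarrow> 'g word \<Rightarrow> bool"
  for R :: "('g word \<times> 'g word) set"
where
  word_eq_refl: "word_eq R u u"
| word_eq_sym: "word_eq R u v \<Longrightarrow> word_eq R v u"
| word_eq_trans: "word_eq R u v \<Longrightarrow> word_eq R v w \<Longrightarrow> word_eq R u w"
| word_eq_append: "word_eq R u u' \<Longrightarrow> word_eq R v v' \<Longrightarrow> word_eq R (u @ v) (u' @ v')"
| word_eq_cancel: "word_eq R [(g, e), (g, \<not> e)] []"
| word_eq_rel: "(l, r) \<in> R \<Longrightarrow> word_eq R l r"

definition word_class :: "('g word \<times> 'g word) set \<Rightarrow> 'g word \<Rightarrow> 'g word set" where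
  "word_class R u = {v. word_eq R u v}"

definition presented_group :: "('g word \<times> 'g word) set \<Rightarrow> 'g word set monoid" where
  "presented_group R =
     \<lparr> carrier = range (word_class R),
       monoid.mult = (\<lambda>A B. {w. \<exists>u\<in>A. \<exists>v\<in>B. word_eq R (u @ v) w}),
       one = word_class R [] \<rparr>"

definition word_value :: "('a, 'b) monoid_scheme \<Rightarrow> ('g \<Rightarrow> 'a) \<Rightarrow> 'g word \<Rightarrow> 'a" where
  "word_value G f u =
     foldr (\<lambda>(g, e) x. (if e then f g else inv\<^bsub>G\<^esub> (f g)) \<otimes>\<^bsub>G\<^esub> x) u \<one>\<^bsub>G\<^esub>"

section \<open>The group of a pretzel link\<close>

text \<open>The Wirtinger presentation of the standard diagram of the \<open>(p\<^sub>1, p\<^sub>2, p\<^sub>3)\<close>-pretzel link,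
  with the crossings inside each column eliminated. Direct both strands of every column downwards.
  A half twist carries the pair of meridians (left strand, right strand) just above a crossing to
  the pair just below it, keeping the product left times right, which is the loop around both
  strands; the two crossing signs are inverse to each other. Exchanging them everywhere gives the
  mirror image of the link.\<close>

definition half_twist :: "'g word \<times> 'g word \<Rightarrow> 'g word \<times> 'g word" where
  "half_twist = (\<lambda>(x, y). (x @ y @ inv_word x, x))"

definition half_twist_inv :: "'g word \<times> 'g word \<Rightarrow> 'g word \<times> 'g word" where
  "half_twist_inv = (\<lambda>(x, y). (y, inv_word y @ x @ y))"

definition twist :: "int \<Rightarrow> 'g word \<times> 'g word \<Rightarrow> 'g word \<times> 'g word" where
  "twist p = (if p \<ge> 0 then half_twist ^^ nat p else half_twist_inv ^^ nat (- p))"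

text \<open>Generators: the meridians of the three arcs that join neighbouring columns at the top. The arc
  from column 1 to column 2 gives \<open>a\<close> (directed down into column 1), the one from column 2 to
  column 3 gives \<open>c\<close> (directed down into column 3), the one from column 3 round to column 1 gives
  \<open>b\<close> (directed down into column 3). Every arc that runs down into one of two adjacent columns runs
  up out of the other one, whence the inverses. The relations are the three joins at the bottom.\<close>

datatype meridian = Mer_a | Mer_b | Mer_c

definition pretzel_relations :: "int \<Rightarrow> int \<Rightarrow> int \<Rightarrow> (meridian word \<times> meridian word) set" where
  "pretzel_relations p\<^sub>1 p\<^sub>2 p\<^sub>3 =
    (let a = [(Mer_a, True)]; b = [(Mer_b, True)]; c = [(Mer_c, True)];
         (l\<^sub>1, r\<^sub>1) = twist p\<^sub>1 (inv_word b, a);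
         (l\<^sub>2, r\<^sub>2) = twist p\<^sub>2 (inv_word a, inv_word c);
         (l\<^sub>3, r\<^sub>3) = twist p\<^sub>3 (c, b)
     in {(r\<^sub>1, inv_word l\<^sub>2), (r\<^sub>2, inv_word l\<^sub>3), (r\<^sub>3, inv_word l\<^sub>1)})"

definition pretzel_link_group :: "int \<Rightarrow> int \<Rightarrow> int \<Rightarrow> meridian word set monoid" where
  "pretzel_link_group p\<^sub>1 p\<^sub>2 p\<^sub>3 = presented_group (pretzel_relations p\<^sub>1 p\<^sub>2 p\<^sub>3)"

definition pretzel_meridian_a :: "int \<Rightarrow> int \<Rightarrow> int \<Rightarrow> meridian word set" where
  "pretzel_meridian_a p\<^sub>1 p\<^sub>2 p\<^sub>3 = word_class (pretzel_relations p\<^sub>1 p\<^sub>2 p\<^sub>3) [(Mer_a, True)]"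

text \<open>The presentation
  \<open>\<langle>a, b, c | b a b\<^sup>-\<^sup>1 = (a c)\<^sup>-\<^sup>m c (a c)\<^sup>m, a\<^sup>-\<^sup>1 b a = (c b)\<^sup>n b (c b)\<^sup>-\<^sup>n\<rangle>\<close>; it is shown below to
  define literally the same group as \<^term>\<open>pretzel_link_group (-2) (2 * m + 1) (2 * n)\<close>.\<close>

definition pretzel_relations_abc :: "int \<Rightarrow> int \<Rightarrow> (meridian word \<times> meridian word) set" where
  "pretzel_relations_abc m n =
    (let a = [(Mer_a, True)]; b = [(Mer_b, True)]; c = [(Mer_c, True)]
     in {(b @ a @ inv_word b, word_pow (a @ c) (- m) @ c @ word_pow (a @ c) m),
         (inv_word a @ b @ a, word_pow (c @ b) n @ b @ word_pow (c @ b) (- n))})"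

section \<open>Trace polynomials and the universal character ring\<close>

definition SL2C :: "(complex^2^2) monoid" where
  "SL2C = \<lparr> carrier = {A. det A = 1}, monoid.mult = (**), one = mat 1 \<rparr>"

datatype letter = A_letter | W_letter

abbreviation "letter_a \<equiv> [(A_letter, True)]"
abbreviation "letter_w \<equiv> [(W_letter, True)]"

abbreviation "free_group_aw \<equiv> presented_group ({} :: (letter word \<times> letter word) set)"
abbreviation "free_class \<equiv> word_class ({} :: (letter word \<times> letter word) set)"

text \<open>\<open>\<complex>[x, y, z]\<close> as iterated univariate polynomials \<open>\<complex>[x][y][z]\<close>: \<open>x\<close> is the innermost variable.\<close>

type_synonym poly_xyz = "complex poly poly poly"

definition var_x :: poly_xyz where "var_x = [:[:[:0, 1:]:]:]"
definition var_y :: poly_xyz where "var_y = [:[:0, 1:]:]"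
definition var_z :: poly_xyz where "var_z = [:0, 1:]"

definition eval_xyz :: "poly_xyz \<Rightarrow> complex \<Rightarrow> complex \<Rightarrow> complex \<Rightarrow> complex" where
  "eval_xyz P x y z = poly (poly (poly P [:[:z:]:]) [:y:]) x"

definition trace_poly :: "letter word \<Rightarrow> poly_xyz" where
  "trace_poly u = (THE P. \<forall>\<rho> \<in> hom free_group_aw SL2C.
     trace (\<rho> (free_class u)) =
       eval_xyz P (trace (\<rho> (free_class letter_a))) (trace (\<rho> (free_class letter_w)))
         (trace (\<rho> (free_class (letter_a @ letter_w)))))"

abbreviation ring_xyz :: "poly_xyz ring" where
  "ring_xyz \<equiv> ring_of_type_algebra"

definition generating_pair :: "('a, 'b) monoid_scheme \<Rightarrow> 'a \<Rightarrow> 'a \<Rightarrow> bool" where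
  "generating_pair G g h \<longleftrightarrow>
     g \<in> carrier G \<and> h \<in> carrier G \<and> generate G {g, h} = carrier G"

definition trace_ideal :: "('a, 'b) monoid_scheme \<Rightarrow> 'a \<Rightarrow> 'a \<Rightarrow> poly_xyz set" where
  "trace_ideal G g h =
     genideal ring_xyz {trace_poly u - trace_poly v | u v.
       word_value G (case_letter g h) u = word_value G (case_letter g h) v}"

text \<open>For a group generated by \<open>g\<close> and \<open>h\<close>, in the coordinates given by \<open>g\<close>, \<open>h\<close> and \<open>g h\<close>.\<close>

definition universal_character_ring ::
  "('a, 'b) monoid_scheme \<Rightarrow> 'a \<Rightarrow> 'a \<Rightarrow> poly_xyz set ring" where
  "universal_character_ring G g h = ring_xyz Quot trace_ideal G g h"

definition nilradical :: "('a, 'b) ring_scheme \<Rightarrow> 'a set" where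
  "nilradical R = {x \<in> carrier R. \<exists>k::nat. x [^]\<^bsub>R\<^esub> k = \<zero>\<^bsub>R\<^esub>}"

definition reduced_ring :: "('a, 'b) ring_scheme \<Rightarrow> bool" where
  "reduced_ring R \<longleftrightarrow> nilradical R = {\<zero>\<^bsub>R\<^esub>}"

section \<open>Chebyshev polynomials with integer index\<close>

text \<open>\<open>cheb_nat j\<close> is \<open>S\<^sub>j\<^sub>-\<^sub>1\<close>; negative indices go by the symmetry \<open>S\<^sub>-\<^sub>k\<^sub>-\<^sub>2 = - S\<^sub>k\<close>.\<close>

fun cheb_nat :: "nat \<Rightarrow> 'a::comm_ring_1 \<Rightarrow> 'a" where
  "cheb_nat 0 t = 0"
| "cheb_nat (Suc 0) t = 1"
| "cheb_nat (Suc (Suc j)) t = t * cheb_nat (Suc j) t - cheb_nat j t"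

definition cheb :: "int \<Rightarrow> 'a::comm_ring_1 \<Rightarrow> 'a" where
  "cheb k t = (if k \<ge> -1 then cheb_nat (nat (k + 1)) t else - cheb_nat (nat (- k - 1)) t)"

lemma cheb_0: "cheb 0 t = 1" and cheb_1: "cheb 1 t = t"
  by (simp_all add: cheb_def numeral_2_eq_2)

lemma cheb_rec: "cheb (k + 1) t = t * cheb k t - cheb (k - 1) t"
proof -
  consider "k \<ge> 0" | "k = -1" | "k \<le> -2" by linarith
  then show ?thesis
  proof cases
    case 1
    then obtain j where "k = int j" using nonneg_int_cases by blast
    then show ?thesis by (simp add: cheb_def nat_add_distrib)
  next
    case 2
    then show ?thesis by (simp add: cheb_def)
  next
    case 3
    define j where "j = nat (- k - 2)"
    have "k = - int j - 2" using 3 by (simp add: j_def)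
    then have "nat (- k - 1) = Suc j" "nat (- (k + 1) - 1) = j" "nat (- (k - 1) - 1) = Suc (Suc j)"
      by simp_all
    with 3 show ?thesis by (cases "k = -2") (auto simp: cheb_def j_def numeral_2_eq_2)
  qed
qed

section \<open>The two-generator presentation\<close>

definition word_u :: "int \<Rightarrow> letter word" where
  "word_u m =
     word_pow (letter_a @ letter_w @ letter_a @ inv_word letter_w) (1 - m) @ letter_w"

definition word_r :: "int \<Rightarrow> int \<Rightarrow> letter word" where
  "word_r m n =
     word_pow (word_u m) (n - 1) @
       letter_a @ letter_w @ letter_a @ inv_word letter_w @ inv_word letter_a"

definition two_generator_relations :: "int \<Rightarrow> int \<Rightarrow> (letter word \<times> letter word) set" where
  "two_generator_relations m n = {(word_r m n, rev (word_r m n))}"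

definition two_generator_group :: "int \<Rightarrow> int \<Rightarrow> letter word set monoid" where
  "two_generator_group m n = presented_group (two_generator_relations m n)"

section \<open>The two presentations of the pretzel link group agree\<close>

lemma inv_word_cancel: "word_eq R (u @ inv_word u) []" "word_eq R (inv_word u @ u) []"
proof (induction u)
  case (Cons x u)
  obtain g e where x: "x = (g, e)" by force
  have i: "inv_word (x # u) = inv_word u @ [(g, \<not> e)]"
    by (simp add: inv_word_def x)
  have 1: "word_eq R ([x] @ ((u @ inv_word u) @ [(g, \<not> e)])) ([x] @ ([] @ [(g, \<not> e)]))"
    by (intro word_eq_append Cons.IH word_eq_refl)
  have 2: "word_eq R (inv_word u @ ([(g, \<not> e), x] @ u)) (inv_word u @ ([] @ u))"
    using word_eq_cancel[of R g "\<not> e"] by (intro word_eq_append word_eq_refl) (simp add: x)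
  have 3: "word_eq R ([x] @ ([] @ [(g, \<not> e)])) []"
    using word_eq_cancel[of R g e] by (simp add: x)
  show "word_eq R ((x # u) @ inv_word (x # u)) []"
    using word_eq_trans[OF 1 3] by (simp add: i)
  show "word_eq R (inv_word (x # u) @ (x # u)) []"
    using word_eq_trans[OF 2] Cons.IH(2) by (simp add: i)
qed (simp_all add: inv_word_def word_eq_refl)

lemma word_class_eq_iff: "word_class R u = word_class R v \<longleftrightarrow> word_eq R u v"
  unfolding word_class_def by (auto intro: word_eq_refl word_eq_sym word_eq_trans)

lemma word_class_append:
  "word_class R u \<otimes>\<^bsub>presented_group R\<^esub> word_class R v = word_class R (u @ v)"
  unfolding presented_group_def word_class_def
  by (auto intro: word_eq_refl word_eq_sym word_eq_trans word_eq_append)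

lemma word_class_in_carrier [simp]: "word_class R u \<in> carrier (presented_group R)"
  by (simp add: presented_group_def)

lemma presented_group_is_group: "group (presented_group R)"
proof (rule groupI)
  fix x assume x: "x \<in> carrier (presented_group R)"
  then obtain u where u: "x = word_class R u" by (auto simp: presented_group_def)
  have one: "\<one>\<^bsub>presented_group R\<^esub> = word_class R []" by (simp add: presented_group_def)
  show "\<one>\<^bsub>presented_group R\<^esub> \<otimes>\<^bsub>presented_group R\<^esub> x = x"
    by (simp add: one u word_class_append)
  show "\<exists>y\<in>carrier (presented_group R). y \<otimes>\<^bsub>presented_group R\<^esub> x = \<one>\<^bsub>presented_group R\<^esub>"
    by (rule bexI[of _ "word_class R (inv_word u)"])
      (simp_all add: one u word_class_append word_class_eq_iff inv_word_cancel)
next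
  fix x y z
  assume "x \<in> carrier (presented_group R)" "y \<in> carrier (presented_group R)"
    "z \<in> carrier (presented_group R)"
  then obtain u v w where "x = word_class R u" "y = word_class R v" "z = word_class R w"
    by (auto simp: presented_group_def)
  then show "x \<otimes>\<^bsub>presented_group R\<^esub> y \<in> carrier (presented_group R)"
    and "x \<otimes>\<^bsub>presented_group R\<^esub> y \<otimes>\<^bsub>presented_group R\<^esub> z =
      x \<otimes>\<^bsub>presented_group R\<^esub> (y \<otimes>\<^bsub>presented_group R\<^esub> z)"
    by (simp_all add: word_class_append)
qed (simp add: presented_group_def)

lemma one_presented_group: "\<one>\<^bsub>presented_group R\<^esub> = word_class R []"
  by (simp add: presented_group_def)

lemma word_class_inv:
  "word_class R (inv_word u) = inv\<^bsub>presented_group R\<^esub> (word_class R u)"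
  by (rule group.inv_equality[OF presented_group_is_group, symmetric])
    (simp_all add: word_class_append word_class_eq_iff inv_word_cancel one_presented_group)

lemma word_class_pow:
  "word_class R (word_pow u k) = word_class R u [^]\<^bsub>presented_group R\<^esub> k"
proof -
  interpret group "presented_group R" by (rule presented_group_is_group)
  have nat: "word_class R (concat (replicate i v)) = word_class R v [^]\<^bsub>presented_group R\<^esub> i"
    for i and v :: "'a word"
  proof (induction i)
    case (Suc i)
    have "word_class R (concat (replicate (Suc i) v)) =
        word_class R v \<otimes>\<^bsub>presented_group R\<^esub> word_class R v [^]\<^bsub>presented_group R\<^esub> i"
      by (simp add: word_class_append[symmetric] Suc.IH)
    then show ?case by (simp only: nat_pow_Suc2 word_class_in_carrier)
  qed (simp add: one_presented_group)
  show ?thesis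
    by (simp add: word_pow_def nat word_class_inv int_pow_def2 nat_pow_inv del: pow_nat)
qed

lemma word_eq_mono:
  assumes "word_eq R u v" and "\<And>l r. (l, r) \<in> R \<Longrightarrow> word_eq R' l r"
  shows "word_eq R' u v"
  using assms(1)
  by induction (auto intro: word_eq_refl word_eq_sym word_eq_trans word_eq_append word_eq_cancel
      assms(2))

context group
begin

definition half_tw :: "'a \<times> 'a \<Rightarrow> 'a \<times> 'a" where
  "half_tw = (\<lambda>(x, y). (x \<otimes> (y \<otimes> inv x), x))"

definition half_tw_inv :: "'a \<times> 'a \<Rightarrow> 'a \<times> 'a" where
  "half_tw_inv = (\<lambda>(x, y). (y, inv y \<otimes> (x \<otimes> y)))"

definition tw :: "int \<Rightarrow> 'a \<times> 'a \<Rightarrow> 'a \<times> 'a" where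
  "tw p = (if p \<ge> 0 then half_tw ^^ nat p else half_tw_inv ^^ nat (- p))"

lemma inv_cancel_left [simp]:
  "x \<in> carrier G \<Longrightarrow> y \<in> carrier G \<Longrightarrow> inv x \<otimes> (x \<otimes> y) = y"
  "x \<in> carrier G \<Longrightarrow> y \<in> carrier G \<Longrightarrow> x \<otimes> (inv x \<otimes> y) = y"
  by (simp_all add: m_assoc[symmetric])

definition conj_pair :: "'a \<Rightarrow> 'a \<times> 'a \<Rightarrow> 'a \<times> 'a" where
  "conj_pair q = (\<lambda>(x, y). (q \<otimes> (x \<otimes> inv q), q \<otimes> (y \<otimes> inv q)))"

lemma conj_pair_conj_pair:
  "p \<in> carrier G \<Longrightarrow> q \<in> carrier G \<Longrightarrow> x \<in> carrier G \<Longrightarrow> y \<in> carrier G \<Longrightarrow>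
   conj_pair p (conj_pair q (x, y)) = conj_pair (p \<otimes> q) (x, y)"
  by (simp add: conj_pair_def m_assoc inv_mult_group)

lemma inv_comm:
  assumes "p \<in> carrier G" "q \<in> carrier G" "q \<otimes> p = p \<otimes> q"
  shows "inv q \<otimes> p = p \<otimes> inv q"
proof -
  have "inv q \<otimes> ((q \<otimes> p) \<otimes> inv q) = inv q \<otimes> ((p \<otimes> q) \<otimes> inv q)"
    by (simp only: assms(3))
  with assms(1,2) show ?thesis by (simp add: m_assoc)
qed

lemma half_tw_power_even:
  assumes [simp]: "x \<in> carrier G" "y \<in> carrier G"
  shows "(half_tw ^^ (2 * j)) (x, y) = conj_pair ((x \<otimes> y) [^] j) (x, y)"
    and "(half_tw_inv ^^ (2 * j)) (x, y) = conj_pair (inv ((x \<otimes> y) [^] j)) (x, y)"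
proof -
  have step: "half_tw (half_tw (u, v)) = conj_pair (u \<otimes> v) (u, v)"
       "half_tw_inv (half_tw_inv (u, v)) = conj_pair (inv (u \<otimes> v)) (u, v)"
    if "u \<in> carrier G" "v \<in> carrier G" for u v
    using that by (simp_all add: half_tw_def half_tw_inv_def conj_pair_def m_assoc inv_mult_group)
  have prod: "(q \<otimes> (x \<otimes> inv q)) \<otimes> (q \<otimes> (y \<otimes> inv q)) = x \<otimes> y"
    if [simp]: "q \<in> carrier G" and c: "q \<otimes> (x \<otimes> y) = (x \<otimes> y) \<otimes> q" for q
  proof -
    have "(q \<otimes> (x \<otimes> inv q)) \<otimes> (q \<otimes> (y \<otimes> inv q)) = (q \<otimes> (x \<otimes> y)) \<otimes> inv q"
      by (simp add: m_assoc)
    then show ?thesis by (simp add: c m_assoc)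
  qed
  have comm: "(x \<otimes> y) [^] j \<otimes> (x \<otimes> y) = (x \<otimes> y) \<otimes> (x \<otimes> y) [^] j" for j :: nat
    by (metis assms m_closed nat_pow_Suc nat_pow_Suc2)
  have comm': "inv ((x \<otimes> y) [^] j) \<otimes> (x \<otimes> y) = (x \<otimes> y) \<otimes> inv ((x \<otimes> y) [^] j)" for j :: nat
    by (intro inv_comm comm) simp_all
  show "(half_tw ^^ (2 * j)) (x, y) = conj_pair ((x \<otimes> y) [^] j) (x, y)"
  proof (induction j)
    case (Suc j)
    let ?q = "(x \<otimes> y) [^] j"
    have "(half_tw ^^ (2 * Suc j)) (x, y) = half_tw (half_tw (conj_pair ?q (x, y)))"
      by (simp add: Suc.IH)
    also have "\<dots> = conj_pair (x \<otimes> y) (conj_pair ?q (x, y))"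
      using prod[of ?q] by (simp add: conj_pair_def[of ?q] step comm)
    also have "\<dots> = conj_pair ((x \<otimes> y) [^] Suc j) (x, y)"
      by (simp add: conj_pair_conj_pair comm)
    finally show ?case .
  qed (simp add: conj_pair_def)
  show "(half_tw_inv ^^ (2 * j)) (x, y) = conj_pair (inv ((x \<otimes> y) [^] j)) (x, y)"
  proof (induction j)
    case (Suc j)
    let ?q = "inv ((x \<otimes> y) [^] j)"
    have "(half_tw_inv ^^ (2 * Suc j)) (x, y) = half_tw_inv (half_tw_inv (conj_pair ?q (x, y)))"
      by (simp add: Suc.IH)
    also have "\<dots> = conj_pair (inv (x \<otimes> y)) (conj_pair ?q (x, y))"
      using prod[of ?q] by (simp add: conj_pair_def[of ?q] step comm')
    also have "\<dots> = conj_pair (inv ((x \<otimes> y) [^] Suc j)) (x, y)"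
      by (simp add: conj_pair_conj_pair inv_mult_group[symmetric] del: inv_mult_group)
    finally show ?case .
  qed (simp add: conj_pair_def)
qed

lemma tw_even:
  assumes "x \<in> carrier G" "y \<in> carrier G"
  shows "tw (2 * k) (x, y) = conj_pair ((x \<otimes> y) [^] k) (x, y)"
  using half_tw_power_even[OF assms, of "nat k"] half_tw_power_even[OF assms, of "nat (- k)"]
  by (auto simp: tw_def int_pow_def2 nat_mult_distrib minus_mult_right simp del: mult_minus_right pow_nat)

lemma half_tw_half_tw_inv:
  assumes "x \<in> carrier G" "y \<in> carrier G"
  shows "half_tw (half_tw_inv (x, y)) = (x, y)"
  using assms by (simp add: half_tw_def half_tw_inv_def m_assoc inv_mult_group)

lemma half_tw_inv_closed:
  "x \<in> carrier G \<Longrightarrow> y \<in> carrier G \<Longrightarrow>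
   (half_tw_inv ^^ i) (x, y) \<in> carrier G \<times> carrier G"
  by (induction i) (auto simp: half_tw_inv_def)

lemma tw_odd:
  assumes "x \<in> carrier G" "y \<in> carrier G"
  shows "tw (2 * k + 1) (x, y) = half_tw (tw (2 * k) (x, y))"
proof (cases "k \<ge> 0")
  case True
  then have "nat (2 * k + 1) = Suc (nat (2 * k))" by simp
  with True show ?thesis by (simp add: tw_def)
next
  case False
  then have n: "nat (- (2 * k)) = Suc (nat (- (2 * k + 1)))" by simp
  obtain u v where uv: "(half_tw_inv ^^ nat (- (2 * k + 1))) (x, y) = (u, v)"
    by force
  then have c: "u \<in> carrier G" "v \<in> carrier G"
    using half_tw_inv_closed[OF assms, of "nat (- (2 * k + 1))"] by auto
  have "tw (2 * k) (x, y) = half_tw_inv (u, v)"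
    using False uv unfolding tw_def n by simp
  moreover have "tw (2 * k + 1) (x, y) = (u, v)"
    using False uv unfolding tw_def by simp
  ultimately show ?thesis using half_tw_half_tw_inv[OF c] by simp
qed

lemma pretzel_group_identities:
  assumes [simp]: "a \<in> carrier G" "b \<in> carrier G" "c \<in> carrier G"
    and t1: "tw (-2) (inv b, a) = (l1, r1)"
    and t2: "tw (2 * m + 1) (inv a, inv c) = (l2, r2)"
    and t3: "tw (2 * n) (c, b) = (l3, r3)"
  shows "r1 = inv l2 \<and> r2 = inv l3 \<and> r3 = inv l1 \<longleftrightarrow>
     b \<otimes> (a \<otimes> inv b) = (a \<otimes> c) [^] (- m) \<otimes> (c \<otimes> (a \<otimes> c) [^] m) \<and>
     inv a \<otimes> (b \<otimes> a) = (c \<otimes> b) [^] n \<otimes> (b \<otimes> (c \<otimes> b) [^] (- n))"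
proof -
  define M where "M = (a \<otimes> c) [^] m"
  define Q where "Q = (c \<otimes> b) [^] n"
  have [simp]: "M \<in> carrier G" "Q \<in> carrier G" by (simp_all add: M_def Q_def)
  have pm: "(a \<otimes> c) [^] (- m) = inv M" "(c \<otimes> b) [^] (- n) = inv Q"
    by (simp_all add: M_def Q_def int_pow_neg)
  have conj_nat: "(inv a \<otimes> (z \<otimes> a)) [^] i = inv a \<otimes> (z [^] i \<otimes> a)"
    if "z \<in> carrier G" for z and i :: nat
    using that by (induction i) (simp_all add: m_assoc)
  have conj_int: "(inv a \<otimes> (z \<otimes> a)) [^] i = inv a \<otimes> (z [^] i \<otimes> a)"
    if "z \<in> carrier G" for z and i :: int
    using that by (simp add: int_pow_def2 conj_nat inv_mult_group m_assoc del: pow_nat)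
  have "(inv a \<otimes> inv c) [^] m = (inv (inv a \<otimes> ((a \<otimes> c) \<otimes> a))) [^] m"
    by (simp add: inv_mult_group m_assoc)
  also have "\<dots> = inv (inv a \<otimes> (M \<otimes> a))"
    unfolding M_def by (subst int_pow_inv) (simp_all add: conj_int)
  finally have p2: "(inv a \<otimes> inv c) [^] m = inv a \<otimes> (inv M \<otimes> a)"
    by (simp add: inv_mult_group m_assoc)
  have p1: "(inv b \<otimes> a) [^] (-1::int) = inv a \<otimes> b"
    using int_pow_neg[of "inv b \<otimes> a" 1] by (simp add: inv_mult_group)
  have e1: "l1 = inv a \<otimes> (inv b \<otimes> a)" "r1 = inv a \<otimes> (b \<otimes> (a \<otimes> (inv b \<otimes> a)))"
    using t1 tw_even[of "inv b" a "-1"]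
    by (simp_all add: p1 conj_pair_def inv_mult_group m_assoc)
  have e3: "l3 = Q \<otimes> (c \<otimes> inv Q)" "r3 = Q \<otimes> (b \<otimes> inv Q)"
    using t3 tw_even[of c b n] by (simp_all add: conj_pair_def Q_def)
  have e2: "l2 = inv a \<otimes> (inv M \<otimes> (inv c \<otimes> (M \<otimes> a)))"
       "l2 \<otimes> r2 = inv a \<otimes> inv c"
  proof -
    have c: "inv M \<otimes> ((a \<otimes> c) \<otimes> M) = a \<otimes> c"
    proof -
      have "(a \<otimes> c) \<otimes> M = M \<otimes> (a \<otimes> c)"
        unfolding M_def using int_pow_mult[of "a \<otimes> c" 1 m] int_pow_mult[of "a \<otimes> c" m 1]
        by (simp add: add.commute)
      then show ?thesis by simp
    qed
    have ic: "inv M \<otimes> (inv c \<otimes> (inv a \<otimes> M)) = inv c \<otimes> inv a"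
      using arg_cong[OF c, of "\<lambda>t. inv t"] by (simp add: inv_mult_group m_assoc)
    have ic': "inv M \<otimes> (inv c \<otimes> (inv a \<otimes> (M \<otimes> t))) = inv c \<otimes> (inv a \<otimes> t)"
      if "t \<in> carrier G" for t
      using arg_cong[OF ic, of "\<lambda>s. s \<otimes> t"] that by (simp add: m_assoc)
    show "l2 = inv a \<otimes> (inv M \<otimes> (inv c \<otimes> (M \<otimes> a)))"
      using t2 tw_odd[of "inv a" "inv c" m] tw_even[of "inv a" "inv c" m]
      by (auto simp: p2 conj_pair_def half_tw_def inv_mult_group m_assoc)
    show "l2 \<otimes> r2 = inv a \<otimes> inv c"
      using t2 tw_odd[of "inv a" "inv c" m] tw_even[of "inv a" "inv c" m]
      by (auto simp: p2 conj_pair_def half_tw_def inv_mult_group m_assoc ic')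
  qed
  have [simp]: "l1 \<in> carrier G" "r1 \<in> carrier G" "l2 \<in> carrier G" "l3 \<in> carrier G" "r3 \<in> carrier G"
    by (simp_all add: e1 e2 e3)
  have r2: "r2 = inv l2 \<otimes> (inv a \<otimes> inv c)"
  proof -
    have "r2 \<in> carrier G"
      using t2 tw_odd[of "inv a" "inv c" m] tw_even[of "inv a" "inv c" m]
      by (auto simp: p2 conj_pair_def half_tw_def)
    then show ?thesis by (simp add: e2(2)[symmetric])
  qed
  have 1: "r1 = inv l2 \<longleftrightarrow> b \<otimes> (a \<otimes> inv b) = inv M \<otimes> (c \<otimes> M)"
  proof -
    have r: "r1 = inv a \<otimes> ((b \<otimes> (a \<otimes> inv b)) \<otimes> a)"
      by (simp add: e1 m_assoc)
    have l: "inv l2 = inv a \<otimes> ((inv M \<otimes> (c \<otimes> M)) \<otimes> a)"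
      by (simp add: e2 inv_mult_group m_assoc)
    show ?thesis unfolding r l by simp
  qed
  have 3: "r3 = inv l1 \<longleftrightarrow> inv a \<otimes> (b \<otimes> a) = Q \<otimes> (b \<otimes> inv Q)"
    by (auto simp: e1 e3 inv_mult_group m_assoc)
  have 2: "r2 = inv l3" if "r1 = inv l2" "r3 = inv l1"
  proof -
    have c: "(c \<otimes> b) \<otimes> Q = Q \<otimes> (c \<otimes> b)"
      unfolding Q_def using int_pow_mult[of "c \<otimes> b" 1 n] int_pow_mult[of "c \<otimes> b" n 1]
      by (simp add: add.commute)
    have "l3 \<otimes> r3 = (Q \<otimes> (c \<otimes> b)) \<otimes> inv Q"
      by (simp add: e3 m_assoc)
    then have "l3 \<otimes> r3 = c \<otimes> b"
      by (simp add: c[symmetric] m_assoc)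
    then have "l3 = (c \<otimes> b) \<otimes> l1"
      using that(2) by (metis inv_inv inv_solve_right \<open>l1 \<in> carrier G\<close> \<open>l3 \<in> carrier G\<close>
          \<open>r3 \<in> carrier G\<close> assms(2,3) m_closed)
    moreover have "r2 = r1 \<otimes> (inv a \<otimes> inv c)" using that(1) r2 by simp
    ultimately show ?thesis
      by (simp add: e1 inv_mult_group m_assoc)
  qed
  show ?thesis unfolding pm M_def[symmetric] Q_def[symmetric] using 1 2 3 by blast
qed

end

lemma twist_word_class:
  "map_prod (word_class R) (word_class R) (twist p (u, v)) =
   group.tw (presented_group R) p (word_class R u, word_class R v)"
proof -
  interpret group "presented_group R" by (rule presented_group_is_group)
  have "map_prod (word_class R) (word_class R) ((half_twist ^^ i) (u, v)) =
        (half_tw ^^ i) (word_class R u, word_class R v)" for i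
    by (induction i) (auto simp: half_twist_def half_tw_def split_beta fst_map_prod snd_map_prod
        word_class_append[symmetric] word_class_inv map_prod_def prod_eq_iff)
  moreover have "map_prod (word_class R) (word_class R) ((half_twist_inv ^^ i) (u, v)) =
        (half_tw_inv ^^ i) (word_class R u, word_class R v)" for i
    by (induction i) (auto simp: half_twist_inv_def half_tw_inv_def split_beta
        word_class_append[symmetric] word_class_inv map_prod_def prod_eq_iff)
  ultimately show ?thesis by (simp add: twist_def tw_def)
qed

lemma pretzel_relations_iff:
  "(\<forall>(l, r) \<in> pretzel_relations (-2) (2 * m + 1) (2 * n). word_eq R l r) \<longleftrightarrow>
   (\<forall>(l, r) \<in> pretzel_relations_abc m n. word_eq R l r)"
proof -
  interpret group "presented_group R" by (rule presented_group_is_group)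
  let ?a = "[(Mer_a, True)]" and ?b = "[(Mer_b, True)]" and ?c = "[(Mer_c, True)]"
  obtain l1 r1 l2 r2 l3 r3 where
    t: "twist (-2) (inv_word ?b, ?a) = (l1, r1)"
       "twist (2 * m + 1) (inv_word ?a, inv_word ?c) = (l2, r2)"
       "twist (2 * n) (?c, ?b) = (l3, r3)"
    by (metis surj_pair)
  have "tw (-2) (inv\<^bsub>presented_group R\<^esub> word_class R ?b, word_class R ?a)
          = (word_class R l1, word_class R r1)"
    using twist_word_class[of R "-2" "inv_word ?b" ?a] by (simp add: t word_class_inv)
  moreover have "tw (2 * m + 1)
        (inv\<^bsub>presented_group R\<^esub> word_class R ?a, inv\<^bsub>presented_group R\<^esub> word_class R ?c)
          = (word_class R l2, word_class R r2)"
    using twist_word_class[of R "2 * m + 1" "inv_word ?a" "inv_word ?c"]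
    by (simp add: t word_class_inv)
  moreover have "tw (2 * n) (word_class R ?c, word_class R ?b) = (word_class R l3, word_class R r3)"
    using twist_word_class[of R "2 * n" ?c ?b] by (simp add: t)
  ultimately have *: "word_class R r1 = word_class R (inv_word l2) \<and>
      word_class R r2 = word_class R (inv_word l3) \<and> word_class R r3 = word_class R (inv_word l1)
    \<longleftrightarrow> word_class R (?b @ (?a @ inv_word ?b)) =
        word_class R (word_pow (?a @ ?c) (- m) @ (?c @ word_pow (?a @ ?c) m)) \<and>
      word_class R (inv_word ?a @ (?b @ ?a)) =
        word_class R (word_pow (?c @ ?b) n @ (?b @ word_pow (?c @ ?b) (- n)))"
    unfolding word_class_append[symmetric] word_class_inv word_class_pow
    by (intro pretzel_group_identities) simp_all
  show ?thesis
    unfolding pretzel_relations_def pretzel_relations_abc_def Let_def t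
    using *[unfolded word_class_eq_iff] by simp
qed

lemma pretzel_link_group_eq:
  "pretzel_link_group (-2) (2 * m + 1) (2 * n) = presented_group (pretzel_relations_abc m n)"
proof -
  let ?R = "pretzel_relations (-2) (2 * m + 1) (2 * n)" and ?R' = "pretzel_relations_abc m n"
  have "word_eq ?R = word_eq ?R'"
  proof (intro ext iffI)
    fix u v
    have 1: "word_eq ?R' l r" if "(l, r) \<in> ?R" for l r
      using pretzel_relations_iff[of m n ?R'] that word_eq_rel[of _ _ ?R'] by auto
    have 2: "word_eq ?R l r" if "(l, r) \<in> ?R'" for l r
      using pretzel_relations_iff[of m n ?R] that word_eq_rel[of _ _ ?R] by auto
    show "word_eq ?R' u v" if "word_eq ?R u v" using that 1 by (rule word_eq_mono)
    show "word_eq ?R u v" if "word_eq ?R' u v" using that 2 by (rule word_eq_mono)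
  qed
  then show ?thesis
    by (simp add: pretzel_link_group_def presented_group_def word_class_def fun_eq_iff)
qed

end

theory Submission
  imports
    Defs
    "HOL-Computational_Algebra.Polynomial_Factorial"
    "HOL-Computational_Algebra.Field_as_Ring"
    "HOL-Computational_Algebra.Fundamental_Theorem_Algebra"
begin

text \<open>For \<open>A, W \<in> SL\<^sub>2(\<complex>)\<close> every word \<open>g\<close> in \<open>A, W\<close> is a combination \<open>p + q A + r W + s A W\<close> with
  coefficients in \<open>\<complex>[x, y, z]\<close>. Trace polynomials are invariant under reversal of words, so
  \<open>P\<^bsub>rg\<^esub> - P\<^bsub>r'g\<^esub>\<close>, where \<open>r'\<close> is the reversal of \<open>r\<close>, vanishes for \<open>g = 1, a, w\<close> and is therefore
  \<open>s (P\<^bsub>raw\<^esub> - P\<^bsub>r'aw\<^esub>)\<close>: a single polynomial \<open>f\<close> generates the trace ideal. By Cayley-Hamilton,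
  powers of words contribute Chebyshev polynomials, which gives \<open>f\<close> in closed form.

  For reducedness it suffices that \<open>f\<close> is zero or squarefree. Write \<open>t = xz - y\<close>, so that
  \<open>\<beta> = yt + 2 - z\<^sup>2\<close>. For fixed \<open>\<beta>\<close> the trace \<open>\<alpha>\<close> is linear in \<open>y, t\<close> and the second factor of
  \<open>f\<close> is linear in \<open>t\<close> for fixed \<open>\<alpha>, \<beta>\<close>. A prime whose square divides \<open>f\<close> also divides the image of
  \<open>f\<close> under the derivation \<open>\<partial>/\<partial>t\<close> at fixed \<open>\<alpha>, \<beta>\<close>. This leaves primes that divide \<open>z\<close> or a
  Chebyshev polynomial in \<open>\<alpha>\<close> or \<open>\<beta>\<close>; over \<open>\<complex>\<close> the latter forces \<open>\<alpha>\<close> or \<open>\<beta>\<close> to be constant modulo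
  the prime, and these cases are excluded by specialization.\<close>

section \<open>Chebyshev polynomials\<close>

lemma cheb_minus_1 [simp]: "cheb (- 1) t = 0" and cheb_minus_2 [simp]: "cheb (- 2) t = - 1"
  by (simp_all add: cheb_def)

lemma cheb_rec_down: "cheb (k - 2) t = t * cheb (k - 1) t - cheb k t"
  using cheb_rec[of "k - 1" t] by (simp add: algebra_simps)

text \<open>The recurrence has order two, so a solution is fixed by two adjacent values. The base
  indices are 0 and -1 because the pair (S_k, S_{k-1}) is (1, 0) at k = 0 and (0, -1) at k =
  -1.\<close>

lemma cheb_rec_unique:
  fixes g :: "int \<Rightarrow> 'a::comm_ring_1"
  assumes "\<And>k. g (k + 1) = t * g k - g (k - 1)"
  shows "g k = g 0 * cheb k t - g (- 1) * cheb (k - 1) t"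
proof -
  let ?P = "\<lambda>k. g k = g 0 * cheb k t - g (- 1) * cheb (k - 1) t"
  \<comment> \<open>Two adjacent indices travel together, since the recurrence involves both and the
    induction runs upwards and downwards from 0.\<close>
  have "?P k \<and> ?P (k - 1)"
  proof (induction k rule: int_induct[where k = 0])
    case base
    show ?case by (simp add: cheb_0)
  next
    case (step1 i)
    have 1: "g (i + 1) = t * (g 0 * cheb i t - g (- 1) * cheb (i - 1) t)
        - (g 0 * cheb (i - 1) t - g (- 1) * cheb (i - 2) t)"
      unfolding assms[of i] using step1.IH by (simp add: diff_diff_eq)
    have "?P (i + 1)" unfolding 1 cheb_rec cheb_rec_down[of i] by (simp add: algebra_simps)
    with step1.IH show ?case by simp
  next
    case (step2 i)
    have "g (i - 2) = t * g (i - 1) - g i"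
      using assms[of "i - 1"] by (simp add: algebra_simps)
    then have 1: "g (i - 2) = t * (g 0 * cheb (i - 1) t - g (- 1) * cheb (i - 2) t)
        - (g 0 * cheb i t - g (- 1) * cheb (i - 1) t)"
      using step2.IH by (simp add: diff_diff_eq)
    have 2: "cheb (i - 2 - 1) t = t * cheb (i - 2) t - cheb (i - 1) t"
      using cheb_rec_down[of "i - 1" t] by simp
    have "?P (i - 2)"
      unfolding 1 2 cheb_rec_down[of i] by (simp add: algebra_simps)
    with step2.IH show ?case by simp
  qed
  then show ?thesis ..
qed

lemma cheb_eqI:
  fixes g :: "int \<Rightarrow> 'a::comm_ring_1"
  assumes "\<And>k. g (k + 1) = t * g k - g (k - 1)" "g 0 = 1" "g (- 1) = 0"
  shows "cheb k t = g k"
  using cheb_rec_unique[of g t k] assms by simp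

text \<open>At 2 the recurrence is that of arithmetic progressions. Together with
  \<open>cheb_neg_arg\<close> this turns specializations with traces 2 or -2 into equations between
  integers.\<close>

lemma cheb_at_2: "cheb k (2 :: 'a::comm_ring_1) = of_int (k + 1)"
  by (rule cheb_eqI) (simp_all add: algebra_simps)

lemma cheb_neg_arg: "cheb k (- t) = (if even k then cheb k t else - cheb k t)"
proof (rule cheb_eqI)
  fix k
  show "(if even (k + 1) then cheb (k + 1) t else - cheb (k + 1) t) =
      - t * (if even k then cheb k t else - cheb k t)
      - (if even (k - 1) then cheb (k - 1) t else - cheb (k - 1) t)"
    by (simp add: cheb_rec)
qed (simp_all add: cheb_0)

lemma cheb_reflect: "cheb (- k) t = - cheb (k - 2) t"
proof -
  have "cheb k t = - cheb (- k - 2) t" for k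
  proof (rule cheb_eqI)
    fix k
    show "- cheb (- (k + 1) - 2) t = t * - cheb (- k - 2) t - - cheb (- (k - 1) - 2) t"
      using cheb_rec[of "- k - 2" t] by (simp add: algebra_simps)
  qed simp_all
  from this[of "k - 2"] show ?thesis by (simp add: algebra_simps)
qed

lemma cheb_hom:
  assumes "\<And>u v. h (u * v) = h u * h v" "\<And>u v. h (u - v) = h u - h v" "h 1 = 1"
  shows "h (cheb k t) = cheb k (h t)"
proof -
  have "h 0 = 0" using assms(2)[of 0 0] by simp
  then show ?thesis
    by (intro cheb_eqI[symmetric]) (simp_all add: cheb_rec cheb_0 assms)
qed

text \<open>The form equals S_k^2 - S_{k+1} S_{k-1}, an invariant of the recurrence. Its value 1
  makes consecutive Chebyshev values coprime.\<close>

lemma cheb_norm: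
  fixes t :: "'a::comm_ring_1"
  shows "cheb k t ^ 2 + cheb (k - 1) t ^ 2 - t * cheb k t * cheb (k - 1) t = 1"
proof -
  let ?N = "\<lambda>k. cheb k t ^ 2 + cheb (k - 1) t ^ 2 - t * cheb k t * cheb (k - 1) t"
  have step: "?N (k + 1) = ?N k" for k
    unfolding cheb_rec by (simp add: power2_eq_square algebra_simps)
  have "?N k = ?N 0"
  proof (induction k rule: int_induct[where k = 0])
    case (step1 i)
    then show ?case using step[of i] by simp
  next
    case (step2 i)
    then show ?case using step[of "i - 1"] by simp
  qed simp
  then show ?thesis by (simp add: cheb_0)
qed

text \<open>Lets an argument be replaced by a congruent one when working modulo a prime.\<close>

lemma cheb_diff_dvd: "u - v dvd cheb k u - cheb k v"
proof -
  have "u - v dvd cheb k u - cheb k v \<and> u - v dvd cheb (k - 1) u - cheb (k - 1) v"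
  proof (induction k rule: int_induct[where k = 0])
    case (step1 i)
    have "cheb (i + 1) u - cheb (i + 1) v = (u - v) * cheb i u + v * (cheb i u - cheb i v)
        - (cheb (i - 1) u - cheb (i - 1) v)"
      unfolding cheb_rec by (simp add: algebra_simps)
    with step1.IH show ?case by simp
  next
    case (step2 i)
    have "cheb (i - 2) u - cheb (i - 2) v
        = (u - v) * cheb (i - 1) u + v * (cheb (i - 1) u - cheb (i - 1) v) - (cheb i u - cheb i v)"
      unfolding cheb_rec_down by (simp add: algebra_simps)
    with step2.IH show ?case by simp
  qed (simp add: cheb_0)
  then show ?thesis ..
qed

section \<open>Derivations\<close>

definition derivation :: "('a::comm_ring_1 \<Rightarrow> 'a) \<Rightarrow> bool" where
  "derivation d \<longleftrightarrow> (\<forall>u v. d (u + v) = d u + d v) \<and> (\<forall>u v. d (u * v) = u * d v + d u * v)"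

lemma
  assumes "derivation d"
  shows derivation_add: "d (u + v) = d u + d v"
    and derivation_mult: "d (u * v) = u * d v + d u * v"
    and derivation_0: "d 0 = 0"
    and derivation_1: "d 1 = 0"
    and derivation_minus: "d (- u) = - d u"
    and derivation_diff: "d (u - v) = d u - d v"
    and derivation_numeral: "d (numeral i) = 0"
    and derivation_power2: "d (u ^ 2) = 2 * u * d u"
proof -
  show add: "d (u + v) = d u + d v" and mult: "d (u * v) = u * d v + d u * v" for u v
    using assms by (auto simp: derivation_def)
  show zero: "d 0 = 0" using add[of 0 0] by simp
  show one: "d 1 = 0" using mult[of 1 1] by simp
  show minus: "d (- u) = - d u" for u
    using add[of u "- u"] zero by (simp add: eq_neg_iff_add_eq_0 add.commute)
  show "d (u - v) = d u - d v" using add[of u "- v"] minus by simp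
  have "d (of_nat j) = 0" for j by (induction j) (simp_all add: zero one add)
  then show "d (numeral i) = 0" by (metis of_nat_numeral)
  show "d (u ^ 2) = 2 * u * d u" by (simp add: power2_eq_square mult algebra_simps)
qed

lemmas derivation_simps = derivation_add derivation_mult derivation_0 derivation_1
  derivation_minus derivation_diff derivation_numeral derivation_power2

lemma derivation_map_poly:
  assumes "derivation (d :: 'a::comm_ring_1 \<Rightarrow> 'a)"
  shows "derivation (map_poly d)"
proof -
  note d = derivation_simps[OF assms]
  have sum: "d (sum f A) = (\<Sum>i\<in>A. d (f i))" for f :: "nat \<Rightarrow> 'a" and A
    by (induction A rule: infinite_finite_induct) (simp_all add: d)
  show ?thesis
    unfolding derivation_def
    by (auto intro!: poly_eqI simp: coeff_map_poly d sum Polynomial.coeff_mult sum.distrib)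
qed

text \<open>The combination a d/dx + b d/dy + c d/dz has the prescribed values. The coefficients may
  be polynomials, which \<open>annihilating_derivation\<close> exploits.\<close>

lemma derivation_exists:
  "\<exists>d. derivation d \<and> d var_x = a \<and> d var_y = b \<and> d var_z = c"
proof -
  have 0: "derivation (pderiv :: 'a poly \<Rightarrow> _)" for dummy :: "'a::idom"
    by (simp add: derivation_def pderiv_add pderiv_mult mult.commute)
  \<comment> \<open>In the nested representation the partial derivative by x acts two coefficient
    levels down, and the one by y one level down.\<close>
  let ?x = "map_poly (map_poly pderiv) :: poly_xyz \<Rightarrow> _"
  let ?y = "map_poly pderiv :: poly_xyz \<Rightarrow> _"
  let ?z = "pderiv :: poly_xyz \<Rightarrow> _"
  have d: "derivation ?x" "derivation ?y" "derivation ?z"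
    using 0 by (auto intro!: derivation_map_poly)
  have "derivation (\<lambda>p. a * ?x p + b * ?y p + c * ?z p)"
    unfolding derivation_def
    by (simp add: derivation_simps(1,2)[OF d(1)] derivation_simps(1,2)[OF d(2)]
        derivation_simps(1,2)[OF d(3)] algebra_simps)
  moreover have "?x var_x = 1" "?x var_y = 0" "?x var_z = 0" "?y var_x = 0" "?y var_y = 1"
    "?y var_z = 0" "?z var_x = 0" "?z var_y = 0" "?z var_z = 1"
    by (simp_all add: var_x_def var_y_def var_z_def map_poly_pCons pderiv_pCons one_pCons)
  ultimately show ?thesis by (intro exI[of _ "\<lambda>p. a * ?x p + b * ?y p + c * ?z p"]) simp
qed

text \<open>The factor t^2 - 4 clears the denominator in the derivative of S_k. The difference of
  the two sides satisfies the Chebyshev recurrence in k and vanishes at 0 and -1.\<close>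

lemma derivation_cheb:
  assumes "derivation d"
  shows "(t ^ 2 - 4) * d (cheb k t) = (of_int k * t * cheb k t - 2 * of_int (k + 1) * cheb (k - 1) t) * d t"
proof -
  note d = derivation_simps[OF assms]
  define g where "g k = (t ^ 2 - 4) * d (cheb k t)
      - (of_int k * t * cheb k t - 2 * of_int (k + 1) * cheb (k - 1) t) * d t" for k
  have "g k = g 0 * cheb k t - g (- 1) * cheb (k - 1) t"
  proof (rule cheb_rec_unique)
    fix k
    have 1: "cheb (k - 1 - 1) t = t * cheb (k - 1) t - cheb k t"
      using cheb_rec_down[of k t] by simp
    show "g (k + 1) = t * g k - g (k - 1)"
      unfolding g_def cheb_rec 1 by (simp add: d algebra_simps power2_eq_square)
  qed
  also have "\<dots> = 0" by (simp add: g_def d cheb_0)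
  finally show ?thesis by (simp add: g_def)
qed

text \<open>By the Leibniz rule a derivative of p^2 k keeps a factor p. This is the test applied to
  repeated primes below.\<close>

lemma derivation_dvd:
  assumes "derivation d" "p * p dvd u"
  shows "p dvd d u"
proof -
  obtain k where "u = p * p * k" using assms(2) by (elim dvdE)
  then have "d u = p * (p * d k + 2 * d p * k)"
    by (simp add: derivation_mult[OF assms(1)] algebra_simps)
  then show ?thesis by simp
qed

lemma derivation_cheb_eq_0:
  assumes "derivation d" "d t = 0"
  shows "d (cheb k t) = 0"
proof -
  note d = derivation_simps[OF assms(1)]
  have "d (cheb k t) = d (cheb 0 t) * cheb k t - d (cheb (- 1) t) * cheb (k - 1) t"
    by (rule cheb_rec_unique) (simp add: cheb_rec d assms(2))
  then show ?thesis by (simp add: d cheb_0)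
qed

section \<open>Evaluation of polynomials in three variables\<close>

definition const_xyz :: "complex \<Rightarrow> poly_xyz" where
  "const_xyz c = [:[:[:c:]:]:]"

lemma eval_xyz_simps [simp]:
  "eval_xyz (p + q) x y z = eval_xyz p x y z + eval_xyz q x y z"
  "eval_xyz (p - q) x y z = eval_xyz p x y z - eval_xyz q x y z"
  "eval_xyz (- p) x y z = - eval_xyz p x y z"
  "eval_xyz (p * q) x y z = eval_xyz p x y z * eval_xyz q x y z"
  "eval_xyz (p ^ j) x y z = eval_xyz p x y z ^ j"
  "eval_xyz 0 x y z = 0"
  "eval_xyz 1 x y z = 1"
  "eval_xyz (numeral i) x y z = numeral i"
  "eval_xyz (of_int k) x y z = of_int k"
  "eval_xyz (const_xyz c) x y z = c"
  "eval_xyz var_x x y z = x"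
  "eval_xyz var_y x y z = y"
  "eval_xyz var_z x y z = z"
  by (simp_all add: eval_xyz_def const_xyz_def var_x_def var_y_def var_z_def)

lemma eval_xyz_cheb [simp]: "eval_xyz (cheb k u) x y z = cheb k (eval_xyz u x y z)"
  by (rule cheb_hom) simp_all

lemma eval_xyz_dvd: "p dvd u \<Longrightarrow> eval_xyz p x y z = 0 \<Longrightarrow> eval_xyz u x y z = 0"
  by (elim dvdE) simp

lemma poly_eq_0_infinite:
  fixes p :: "'a::idom poly"
  assumes "infinite (range g)" "\<And>c. poly p (g c) = 0"
  shows "p = 0"
  using assms poly_roots_finite[of p] finite_subset[of "range g" "{x. poly p x = 0}"] by blast

text \<open>The variables are peeled off one at a time, x first: a univariate polynomial over a
  domain with infinitely many zeros vanishes, and constants supply these zeros at each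
  level.\<close>

lemma eval_xyz_eqI:
  assumes "\<And>x y z. eval_xyz p x y z = eval_xyz q x y z"
  shows "p = q"
proof -
  have inf: "infinite (range (\<lambda>c::complex. [:c:]))" "infinite (range (\<lambda>c::complex. [:[:c:]:]))"
    by (auto dest!: finite_imageD simp: inj_on_def infinite_UNIV_char_0)
  let ?r = "p - q"
  have "poly (poly (poly ?r [:[:z:]:]) [:y:]) x = 0" for x y z
    using assms[of x y z] by (simp add: eval_xyz_def)
  then have "poly (poly ?r [:[:z:]:]) [:y:] = 0" for y z
    using poly_all_0_iff_0 by blast
  then have "poly ?r [:[:z:]:] = 0" for z
    by (rule poly_eq_0_infinite[OF inf(1)])
  then have "?r = 0" by (rule poly_eq_0_infinite[OF inf(2)])
  then show ?thesis by simp
qed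

lemma poly_xyz_induct [case_names const x y z add mult]:
  assumes "\<And>c. P (const_xyz c)" "P var_x" "P var_y" "P var_z"
    and add: "\<And>p q. P p \<Longrightarrow> P q \<Longrightarrow> P (p + q)" and mult: "\<And>p q. P p \<Longrightarrow> P q \<Longrightarrow> P (p * q)"
  shows "P p"
proof -
  have 0: "P 0" using assms(1)[of 0] by (simp add: const_xyz_def)
  have 1: "P [:[:q:]:]" for q :: "complex poly"
  proof (induction q)
    case (pCons c q)
    have eq: "[:[:pCons c q:]:] = const_xyz c + var_x * [:[:q:]:]"
      by (simp add: const_xyz_def var_x_def)
    from add[OF assms(1) mult[OF assms(2) pCons.IH]] show ?case unfolding eq .
  qed (simp add: 0)
  have 2: "P [:q:]" for q :: "complex poly poly"
  proof (induction q)
    case (pCons c q)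
    have eq: "[:pCons c q:] = [:[:c:]:] + var_y * [:q:]"
      by (simp add: var_y_def)
    from add[OF 1[of c] mult[OF assms(3) pCons.IH]] show ?case unfolding eq .
  qed (simp add: 0)
  show ?thesis
  proof (induction p)
    case (pCons c q)
    have eq: "pCons c q = [:c:] + var_z * q"
      by (simp add: var_z_def)
    from add[OF 2 mult[OF assms(4) pCons.IH]] show ?case unfolding eq .
  qed (simp add: 0)
qed

text \<open>Takes the place of the Nullstellensatz. The leading coefficient of p in z is a unit too,
  so specializing x and y keeps the degree, which is positive, and the fundamental theorem of
  algebra yields z.\<close>

lemma exists_eval_xyz_root:
  assumes "p dvd u" "Polynomial.lead_coeff u dvd 1" "\<not> p dvd 1"
  shows "\<exists>z. eval_xyz p x y z = 0"
proof -
  let ?h = "\<lambda>c :: complex poly poly. poly (poly c [:y:]) x"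
  obtain q where q: "u = p * q" using assms(1) by (elim dvdE)
  then have lc: "Polynomial.lead_coeff p dvd 1"
    using assms(2) by (simp add: Polynomial.lead_coeff_mult dvd_mult_left)
  then obtain r where "1 = Polynomial.lead_coeff p * r" by (elim dvdE)
  then have "1 = ?h (Polynomial.lead_coeff p) * ?h r" by (metis poly_1 poly_mult)
  then have nz: "?h (Polynomial.lead_coeff p) \<noteq> 0" by auto
  have "Polynomial.degree p \<noteq> 0"
  proof
    assume "Polynomial.degree p = 0"
    then obtain c where c: "p = [:c:]" by (metis degree_eq_zeroE)
    with \<open>1 = Polynomial.lead_coeff p * r\<close> have "1 = p * [:r:]" by (simp add: one_pCons)
    with assms(3) show False by (metis dvd_triv_left)
  qed
  moreover have "Polynomial.coeff (map_poly ?h p) (Polynomial.degree p) \<noteq> 0"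
    using nz by (simp add: coeff_map_poly)
  ultimately have "Polynomial.degree (map_poly ?h p) \<noteq> 0"
    by (metis le_degree le_zero_eq)
  then have "\<not> Fundamental_Theorem_Algebra.constant (poly (map_poly ?h p))"
    by (simp add: constant_degree)
  then obtain z where "poly (map_poly ?h p) z = 0"
    using fundamental_theorem_of_algebra by blast
  moreover have "poly (map_poly ?h q) z = eval_xyz q x y z" for q
    by (induction q) (simp_all add: map_poly_pCons eval_xyz_def)
  ultimately show ?thesis by auto
qed

section \<open>Prime divisors of a univariate polynomial in one element\<close>

definition poly_subst :: "complex poly \<Rightarrow> poly_xyz \<Rightarrow> poly_xyz" where
  "poly_subst q u = poly (map_poly const_xyz q) u"

lemma eval_xyz_poly_subst [simp]: "eval_xyz (poly_subst q u) x y z = poly q (eval_xyz u x y z)"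
  by (induction q) (simp_all add: poly_subst_def map_poly_pCons const_xyz_def[of 0])

text \<open>Over the complex numbers q splits into linear factors, and the induction removes one of
  them per step. At degree 0 the value is a unit, which no prime divides.\<close>

lemma prime_dvd_poly_subst:
  assumes "prime_elem p" "p dvd poly_subst q u" "q \<noteq> 0"
  shows "\<exists>c. p dvd u - const_xyz c"
  using assms(2,3)
proof (induction "Polynomial.degree q" arbitrary: q)
  case 0
  then obtain c where c: "q = [:c:]" by (metis degree_eq_zeroE)
  with 0 have "c \<noteq> 0" by auto
  have "poly_subst q u * const_xyz (1 / c) = 1"
    using \<open>c \<noteq> 0\<close> by (intro eval_xyz_eqI) (simp add: c)
  with 0 have "p dvd 1" by (metis dvd_mult2)
  with assms(1) show ?case by (simp add: prime_elem_def)
next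
  case (Suc j)
  have "\<not> Fundamental_Theorem_Algebra.constant (poly q)"
    using Suc by (simp add: constant_degree)
  then obtain c where "poly q c = 0" using fundamental_theorem_of_algebra by blast
  then obtain r where r: "q = [:- c, 1:] * r" by (auto simp: poly_eq_0_iff_dvd)
  with Suc have "r \<noteq> 0" by auto
  then have "Polynomial.degree q = Suc (Polynomial.degree r)"
    unfolding r by (simp add: degree_mult_eq del: mult_pCons_left)
  with Suc have deg: "j = Polynomial.degree r" by simp
  have "poly_subst q u = (u - const_xyz c) * poly_subst r u"
    by (intro eval_xyz_eqI) (simp add: r algebra_simps)
  with Suc assms(1) have "p dvd u - const_xyz c \<or> p dvd poly_subst r u"
    by (simp add: prime_elem_dvd_mult_iff)
  with Suc(1)[OF deg] \<open>r \<noteq> 0\<close> show ?case by blast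
qed

section \<open>The defining polynomial is squarefree\<close>

text \<open>\<open>tr_B\<close>, \<open>tr_awa\<close> and \<open>tr_u m\<close> are closed forms
  for the traces of a w a w^-1, a w a and \<open>word_u m\<close>. They are matched with the words
  only later, so squarefreeness is treated as pure algebra.\<close>

definition tr_B :: poly_xyz where
  "tr_B = var_x * var_y * var_z + 2 - var_y ^ 2 - var_z ^ 2"

definition tr_awa :: poly_xyz where
  "tr_awa = var_x * var_z - var_y"

definition tr_u :: "int \<Rightarrow> poly_xyz" where
  "tr_u m = var_y * cheb (m - 1) tr_B - tr_awa * cheb (m - 2) tr_B"

text \<open>This is 2 minus the trace of the commutator of a and w; its zeros are the characters of
  reducible representations.\<close>

definition abelian_factor :: poly_xyz where
  "abelian_factor = var_x * var_y * var_z + 4 - var_x ^ 2 - var_y ^ 2 - var_z ^ 2"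

definition nonabelian_factor :: "int \<Rightarrow> int \<Rightarrow> poly_xyz" where
  "nonabelian_factor m n = tr_awa * cheb (n - 1) (tr_u m)
     - (cheb m tr_B - cheb (m - 1) tr_B) * cheb (n - 2) (tr_u m)"

lemma eval_xyz_traces [simp]:
  "eval_xyz tr_B x y z = x * y * z + 2 - y ^ 2 - z ^ 2"
  "eval_xyz tr_awa x y z = x * z - y"
  "eval_xyz abelian_factor x y z = x * y * z + 4 - x ^ 2 - y ^ 2 - z ^ 2"
  by (simp_all add: tr_B_def tr_awa_def abelian_factor_def)

context
  fixes p :: poly_xyz
  assumes prime: "prime_elem p"
begin

section \<open>Divisibility by a fixed prime\<close>

lemma not_dvd_1: "\<not> p dvd 1"
  using prime by (simp add: prime_elem_def)

lemma dvd_mult_iff: "p dvd u * v \<longleftrightarrow> p dvd u \<or> p dvd v"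
  using prime by (rule prime_elem_dvd_mult_iff)

lemma square_dvd_mult_cancel:
  assumes "p * p dvd u * v" "\<not> p dvd u"
  shows "p * p dvd v"
proof -
  have "p dvd u * v" using assms(1) by (rule dvd_mult_left)
  with assms(2) obtain k where k: "v = p * k" by (auto simp: dvd_mult_iff)
  have "p \<noteq> 0" using prime by (simp add: prime_elem_def)
  with assms(1) k have "p dvd u * k" by (simp add: mult.left_commute)
  with assms(2) k show ?thesis by (simp add: dvd_mult_iff)
qed

lemma not_dvd_const: "c \<noteq> 0 \<Longrightarrow> \<not> p dvd const_xyz c"
proof
  assume "c \<noteq> 0" "p dvd const_xyz c"
  then have "p dvd const_xyz c * const_xyz (1 / c)" by simp
  also have "const_xyz c * const_xyz (1 / c) = 1"
    using \<open>c \<noteq> 0\<close> by (intro eval_xyz_eqI) simp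
  finally show False using not_dvd_1 by simp
qed

lemma not_dvd_of_int: "k \<noteq> 0 \<Longrightarrow> \<not> p dvd of_int k"
proof -
  have "of_int k = const_xyz (of_int k)" by (intro eval_xyz_eqI) simp
  then show "k \<noteq> 0 \<Longrightarrow> \<not> p dvd of_int k" by (simp add: not_dvd_const)
qed

text \<open>Otherwise p would divide the norm form of \<open>cheb_norm\<close>, which is 1.\<close>

lemma not_dvd_cheb_consecutive: "p dvd cheb k u \<Longrightarrow> \<not> p dvd cheb (k - 1) u"
proof
  assume "p dvd cheb k u" "p dvd cheb (k - 1) u"
  then have "p dvd cheb k u * cheb k u + cheb (k - 1) u * cheb (k - 1) u - u * cheb k u * cheb (k - 1) u"
    by simp
  then show False
    using cheb_norm[of k u] not_dvd_1 by (simp add: power2_eq_square)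
qed

text \<open>For k different from -1, S_k is a nonzero polynomial in one variable, as its value k + 1
  at 2 shows; so \<open>prime_dvd_poly_subst\<close> applies.\<close>

lemma dvd_cheb_imp_dvd_minus_const:
  assumes "p dvd cheb k u" "k \<noteq> - 1"
  shows "\<exists>c. p dvd u - const_xyz c"
proof (rule prime_dvd_poly_subst[OF prime])
  have 1: "poly (cheb k [:0, 1:]) x = cheb k x" for x :: complex
    using cheb_hom[of "\<lambda>q. poly q x" k "[:0, 1:]"] by simp
  show "p dvd poly_subst (cheb k [:0, 1:]) u"
    using assms(1) eval_xyz_eqI[of "poly_subst (cheb k [:0, 1:]) u" "cheb k u"] by (simp add: 1)
  have "cheb k (2 :: complex) \<noteq> 0"
    using assms(2) by (simp add: cheb_at_2 of_int_add[symmetric] del: of_int_add)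
  then show "cheb k [:0, 1:] \<noteq> (0 :: complex poly)"
    using 1[of 2] by auto
qed

text \<open>Up to sign, \<^const>\<open>tr_B\<close> and \<^const>\<open>abelian_factor\<close> are monic in \<open>z\<close>, so
  a prime divisor has a zero above every \<open>(x, y)\<close>.\<close>

lemma zero_of_divisor_tr_B:
  assumes "p dvd tr_B - const_xyz b"
  obtains z where "eval_xyz p x y z = 0"
proof -
  have "tr_B - const_xyz b = [:[:[:2 - b:], 0, -1:], [:0, [:0, 1:]:], -1:]"
    by (simp add: tr_B_def const_xyz_def var_x_def var_y_def var_z_def power2_eq_square
        one_pCons numeral_poly)
  then have "Polynomial.lead_coeff (tr_B - const_xyz b) dvd 1" by simp
  with assms not_dvd_1 that show ?thesis using exists_eval_xyz_root by metis
qed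

lemma zero_of_divisor_abelian_factor:
  assumes "p dvd abelian_factor"
  obtains z where "eval_xyz p x y z = 0"
proof -
  have eq: "abelian_factor = [:[:[:4, 0, -1:], 0, -1:], [:0, [:0, 1:]:], -1:]"
    by (simp add: abelian_factor_def var_x_def var_y_def var_z_def power2_eq_square
        one_pCons numeral_poly)
  have "Polynomial.lead_coeff abelian_factor dvd 1" unfolding eq by simp
  with assms not_dvd_1 that show ?thesis using exists_eval_xyz_root by metis
qed

lemma zero_of_divisor_var_z:
  assumes "p dvd var_z"
  shows "eval_xyz p x y 0 = 0"
proof -
  have "Polynomial.lead_coeff var_z dvd 1" by (simp add: var_z_def)
  then obtain z where z: "eval_xyz p x y z = 0"
    using assms not_dvd_1 exists_eval_xyz_root by metis
  then show ?thesis using eval_xyz_dvd[OF assms z] by simp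
qed

text \<open>Where \<open>tr_B\<close> is constant modulo p, \<open>tr_u m\<close> becomes a constant
  combination of y and \<open>tr_awa\<close>; this lemma excludes that it is constant as well.
  Common zeros exist above every (x, y): (0, 0) gives a = 0, (0, 1) gives s = -t, and for x = 1 a
  nonzero t forces z = 0, hence 2 - b = y^2 for all y.\<close>

lemma tr_B_linear_form_coprime:
  assumes "p dvd tr_B - const_xyz b"
    and "p dvd const_xyz s * var_y - const_xyz t * tr_awa - const_xyz a"
  shows "s = 0 \<and> t = 0"
proof -
  have sol: "\<exists>z. x * y * z + 2 - b = y ^ 2 + z ^ 2 \<and> s * y - t * (x * z - y) = a" for x y
  proof -
    obtain z where "eval_xyz p x y z = 0" using zero_of_divisor_tr_B[OF assms(1)] by blast
    from eval_xyz_dvd[OF assms(1) this] eval_xyz_dvd[OF assms(2) this]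
    show ?thesis by (intro exI[of _ z]) (simp add: algebra_simps)
  qed
  have "a = 0" using sol[of 0 0] by simp
  with sol[of 0 1] have st: "s = - t" by (simp add: eq_neg_iff_add_eq_0)
  have "t = 0"
  proof (rule ccontr)
    assume "t \<noteq> 0"
    then have "2 - b = y ^ 2" for y
      using sol[of 1 y] by (auto simp: st \<open>a = 0\<close> algebra_simps)
    from this[of 0] this[of 1] show False by simp
  qed
  with st show ?thesis by simp
qed

lemma tr_B_var_y_coprime: "p dvd tr_B - const_xyz b \<Longrightarrow> \<not> p dvd var_y"
proof -
  have "const_xyz 1 * var_y - const_xyz 0 * tr_awa - const_xyz 0 = var_y"
    by (intro eval_xyz_eqI) simp
  then show "p dvd tr_B - const_xyz b \<Longrightarrow> \<not> p dvd var_y"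
    using tr_B_linear_form_coprime[of b 1 0 0] by auto
qed

lemma tr_B_var_z_coprime:
  assumes "p dvd tr_B - const_xyz b"
  shows "\<not> p dvd var_z"
proof
  assume "p dvd var_z"
  then have "2 - b = y ^ 2" for y
    using eval_xyz_dvd[OF assms zero_of_divisor_var_z[of 0 y]] by (simp add: algebra_simps)
  from this[of 0] this[of 1] show False by simp
qed

text \<open>Above (0, 0) the z-derivative x y - 2 z vanishes only at z = 0, where
  \<open>abelian_factor\<close> has the value 4.\<close>

lemma abelian_factor_squarefree: "\<not> p * p dvd abelian_factor"
proof
  assume sq: "p * p dvd abelian_factor"
  then have "p dvd abelian_factor" by (rule dvd_mult_left)
  then obtain z where z: "eval_xyz p 0 0 z = 0" by (rule zero_of_divisor_abelian_factor)
  obtain d where d: "derivation d" "d var_x = 0" "d var_y = 0" "d var_z = 1"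
    using derivation_exists by blast
  have "p dvd d abelian_factor" using d(1) sq by (rule derivation_dvd)
  then have "p dvd var_x * var_y - 2 * var_z"
    by (simp add: abelian_factor_def derivation_simps[OF d(1)] d(2-))
  from eval_xyz_dvd[OF this z] have "z = 0" by simp
  with eval_xyz_dvd[OF \<open>p dvd abelian_factor\<close> z] show False by simp
qed

text \<open>Here \<open>tr_B\<close> and \<open>tr_awa\<close> are -2 and \<open>tr_u m\<close> is 2
  or -2, so all Chebyshev values are, up to sign, linear in their index. The point lies both on z =
  0 and on the zero set of \<open>abelian_factor\<close>.\<close>

lemma nonabelian_factor_at_0_2_0:
  assumes "eval_xyz (nonabelian_factor m n) 0 2 0 = 0"
  shows "(2 * m - 1) * (n - 1) = 2"
proof -
  have at_m2: "cheb k (- 2 :: complex) = (if even k then of_int (k + 1) else - of_int (k + 1))" for k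
    using cheb_neg_arg[of k "2 :: complex"] cheb_at_2[of k, where 'a = complex] by simp
  have u: "eval_xyz (tr_u m) 0 2 0 = (if even m then - 2 else 2)"
    by (simp add: tr_u_def at_m2 algebra_simps)
  have "complex_of_int ((2 * m - 1) * (n - 1) - 2) = 0"
    using assms by (auto simp: nonabelian_factor_def u at_m2 cheb_at_2 algebra_simps split: if_splits)
  then show ?thesis by (simp only: of_int_eq_0_iff)
qed

text \<open>The pair in the conclusion is one at which \<open>nonabelian_factor\<close> is the zero
  polynomial. The equations for m and n come from two points on the zero set of
  \<open>abelian_factor\<close>.\<close>

lemma factors_coprime:
  assumes "p dvd abelian_factor" "p dvd nonabelian_factor m n"
  shows "n = - 1 \<and> m = 0"
proof -
  have "n = - 1"
  proof -
    \<comment> \<open>Above (2, 2) the only zero of \<open>abelian_factor\<close> has z = 2, the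
      character of the trivial representation; \<open>nonabelian_factor\<close> takes the value n +
      1 there.\<close>
    obtain z where z: "eval_xyz p 2 2 z = 0"
      using zero_of_divisor_abelian_factor[OF assms(1)] by blast
    have "(z - 2) ^ 2 = 0"
      using eval_xyz_dvd[OF assms(1) z] by (simp add: power2_eq_square algebra_simps)
    then have "z = 2" by simp
    have "complex_of_int (n + 1) = 0"
      using eval_xyz_dvd[OF assms(2) z]
      by (simp add: \<open>z = 2\<close> nonabelian_factor_def tr_u_def cheb_at_2 algebra_simps)
    then have "n + 1 = 0" by (simp only: of_int_eq_0_iff)
    then show ?thesis by simp
  qed
  moreover have "m = 0"
  proof -
    \<comment> \<open>Above (0, 2) \<open>abelian_factor\<close> is -z^2, which forces z =
      0.\<close>
    obtain z where z: "eval_xyz p 0 2 z = 0"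
      using zero_of_divisor_abelian_factor[OF assms(1)] by blast
    have "z = 0"
      using eval_xyz_dvd[OF assms(1) z] by simp
    with eval_xyz_dvd[OF assms(2) z] have "(2 * m - 1) * (n - 1) = 2"
      by (intro nonabelian_factor_at_0_2_0) simp
    with \<open>n = - 1\<close> show ?thesis by simp
  qed
  ultimately show ?thesis ..
qed

text \<open>Modulo p, \<open>derivation_cheb\<close> leaves only the term with 2 (k + 1) S_{k-1}(u)
  d u, and S_{k-1}(u) has no prime in common with S_k(u).\<close>

lemma cheb_squarefree:
  assumes "p * p dvd cheb k u" "derivation d" "\<not> p dvd d u"
  shows "k = - 1"
proof (rule ccontr)
  assume k: "k \<noteq> - 1"
  have 1: "p dvd cheb k u" using assms(1) by (rule dvd_mult_left)
  have "p dvd (u ^ 2 - 4) * d (cheb k u)"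
    using derivation_dvd[OF assms(2,1)] by simp
  then have "p dvd of_int k * u * cheb k u - 2 * of_int (k + 1) * cheb (k - 1) u"
    using assms(3) by (simp only: derivation_cheb[OF assms(2)] dvd_mult_iff) simp
  then have "p dvd of_int (2 * (k + 1)) * cheb (k - 1) u"
    using 1 by (metis (no_types, lifting) dvd_diff dvd_mult diff_diff_eq2 add_diff_cancel_left'
        of_int_mult of_int_numeral)
  moreover have "\<not> p dvd of_int (2 * (k + 1))"
    using k by (intro not_dvd_of_int) simp
  ultimately show False
    using not_dvd_cheb_consecutive[OF 1] by (simp only: dvd_mult_iff) simp
qed

lemma nonabelian_factor_not_dvd_var_z:
  assumes "p * p dvd nonabelian_factor m n" "m \<noteq> 0"
  shows "\<not> p dvd var_z"
proof
  assume z: "p dvd var_z"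
  have "p dvd nonabelian_factor m n" using assms(1) by (rule dvd_mult_left)
  from eval_xyz_dvd[OF this zero_of_divisor_var_z[OF z]]
  have eq: "(2 * m - 1) * (n - 1) = 2" by (rule nonabelian_factor_at_0_2_0)
  \<comment> \<open>An odd divisor of 2 is 1 or -1, which leaves only m = 1, n = 3 for direct
    inspection.\<close>
  then have "2 * m - 1 dvd 2" by (metis dvd_triv_left)
  then have "\<bar>2 * m - 1\<bar> \<le> 2" using zdvd_imp_le[of "\<bar>2 * m - 1\<bar>" 2] by simp
  with assms(2) have m: "m = 1" by linarith
  with eq have n: "n = 3" by simp
  have cheb2: "cheb 2 var_y = var_y * var_y - 1"
    using cheb_rec[of 1 var_y] by (simp add: cheb_0 cheb_1)
  have Q: "nonabelian_factor m n = var_z * (var_y * var_z - var_x)"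
    by (simp add: m n cheb2 nonabelian_factor_def tr_u_def cheb_0 cheb_1 tr_awa_def tr_B_def
        power2_eq_square algebra_simps)
  obtain d where d: "derivation d" "d var_x = 0" "d var_y = 0" "d var_z = 1"
    using derivation_exists by blast
  \<comment> \<open>On z = 0 this z-derivative is -x, which does not vanish identically.\<close>
  have "p dvd 2 * var_y * var_z - var_x"
    using derivation_dvd[OF d(1) assms(1)]
    by (simp add: Q derivation_simps[OF d(1)] d(2-) algebra_simps)
  from eval_xyz_dvd[OF this zero_of_divisor_var_z[OF z]] show False
    by (metis eval_xyz_simps zero_neq_one diff_0 minus_zero mult_zero_right neg_equal_0_iff_equal)
qed

lemma dvd_cheb_diff_imp_dvd_minus_const:
  assumes "p dvd cheb m u - cheb (m - 1) u"
  shows "\<exists>c. p dvd u - const_xyz c"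
proof (rule prime_dvd_poly_subst[OF prime])
  let ?q = "cheb m [:0, 1:] - cheb (m - 1) [:0, 1:] :: complex poly"
  have 1: "poly (cheb k [:0, 1:]) x = cheb k x" for k and x :: complex
    using cheb_hom[of "\<lambda>q. poly q x" k "[:0, 1:]"] by simp
  show "p dvd poly_subst ?q u"
    using assms eval_xyz_eqI[of "poly_subst ?q u" "cheb m u - cheb (m - 1) u"] by (simp add: 1)
  have "poly ?q 2 = 1" by (simp add: 1 cheb_at_2)
  then show "?q \<noteq> 0" by auto
qed

text \<open>This is the case \<open>n = 0\<close>, where \<^const>\<open>nonabelian_factor\<close> depends on \<^const>\<open>tr_B\<close> only.\<close>

lemma cheb_diff_tr_B_squarefree: "\<not> p * p dvd cheb m tr_B - cheb (m - 1) tr_B"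
proof
  let ?c = "cheb m tr_B - cheb (m - 1) tr_B"
  assume sq: "p * p dvd ?c"
  then have c: "p dvd ?c" by (rule dvd_mult_left)
  have s: "\<not> p dvd cheb m tr_B"
    using not_dvd_cheb_consecutive[of m tr_B] c by (metis diff_diff_eq2 dvd_diff add_diff_cancel_left')
  obtain b where b: "p dvd tr_B - const_xyz b"
    using dvd_cheb_diff_imp_dvd_minus_const[OF c] by blast
  obtain d where d: "derivation d" "d var_x = 1" "d var_y = 0" "d var_z = 0"
    using derivation_exists by blast
  have dB: "d tr_B = var_y * var_z"
    by (simp add: tr_B_def derivation_simps[OF d(1)] d(2-))
  have "p dvd (tr_B ^ 2 - 4) * d ?c"
    using derivation_dvd[OF d(1) sq] by simp
  \<comment> \<open>With S_{m-1} written as S_m - \<open>?c\<close>, the factor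
    \<open>tr_B - 2\<close> splits off, and modulo p the last factor is (2 m + 1)
    S_m(\<open>tr_B\<close>).\<close>
  also have "(tr_B ^ 2 - 4) * d ?c = var_y * (var_z * ((tr_B - 2) *
      (of_int (2 * m + 1) * cheb m tr_B - of_int (m + 1) * ?c)))"
  proof -
    have 1: "cheb (m - 1 - 1) tr_B = tr_B * cheb (m - 1) tr_B - cheb m tr_B"
      using cheb_rec_down[of m tr_B] by simp
    show ?thesis
      unfolding derivation_diff[OF d(1)] right_diff_distrib derivation_cheb[OF d(1)] dB 1
      by (simp add: algebra_simps)
  qed
  finally have "p dvd tr_B - 2 \<or> p dvd of_int (2 * m + 1) * cheb m tr_B - of_int (m + 1) * ?c"
    using tr_B_var_y_coprime[OF b] tr_B_var_z_coprime[OF b] by (simp only: dvd_mult_iff) blast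
  then show False
  proof
    \<comment> \<open>At argument 2 the difference S_m - S_{m-1} is 1, so p would divide 1.\<close>
    assume "p dvd tr_B - 2"
    then have "p dvd cheb m tr_B - of_int (m + 1)" "p dvd cheb (m - 1) tr_B - of_int m"
      using cheb_diff_dvd[of tr_B 2 m] cheb_diff_dvd[of tr_B 2 "m - 1"]
      by (auto simp: cheb_at_2 intro: dvd_trans)
    from dvd_add[OF dvd_diff[OF c this(1)] this(2)] not_dvd_1 show False by simp
  next
    assume "p dvd of_int (2 * m + 1) * cheb m tr_B - of_int (m + 1) * ?c"
    from dvd_add[OF this dvd_mult[OF c, of "of_int (m + 1)"]]
    have "p dvd of_int (2 * m + 1) * cheb m tr_B" by simp
    moreover have "\<not> p dvd of_int (2 * m + 1)"
      by (intro not_dvd_of_int) presburger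
    ultimately show False using s by (simp only: dvd_mult_iff) simp
  qed
qed

text \<open>The derivation that annihilates both \<^const>\<open>tr_B\<close> and \<^const>\<open>tr_u\<close>; the factor
  \<open>2 z\<^sup>2\<close> clears its denominators.\<close>

lemma annihilating_derivation:
  obtains d where "derivation d" "d tr_B = 0" "d (tr_u m) = 0"
    "d tr_awa = 2 * var_z ^ 2 * cheb (m - 1) tr_B"
proof -
  define s where "s = cheb (m - 1) tr_B"
  define t where "t = cheb (m - 2) tr_B"
  \<comment> \<open>If d kills s and t, then \<open>d (tr_u m) = 0\<close> makes the values at y and
    \<open>tr_awa\<close> proportional to t and s. The form y \<open>tr_awa\<close> + 2 - z^2 of
    \<open>tr_B\<close> then dictates the value at z, and \<open>tr_awa\<close> = x z - y the value
    at x.\<close>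
  obtain d where d: "derivation d" "d var_y = 2 * var_z ^ 2 * t"
    "d var_z = var_z * (t * tr_awa + s * var_y)"
    "d var_x = 2 * var_z * (s + t) - var_x * (t * tr_awa + s * var_y)"
    using derivation_exists by blast
  note ds = derivation_simps[OF d(1)]
  have awa: "d tr_awa = 2 * var_z ^ 2 * s"
    by (simp add: tr_awa_def ds d(2-) algebra_simps power2_eq_square)
  have B: "d tr_B = 0"
    by (simp add: tr_B_def ds d(2-) algebra_simps power2_eq_square tr_awa_def)
  have "d s = 0" "d t = 0" unfolding s_def t_def using derivation_cheb_eq_0[OF d(1) B] by auto
  then have "d (tr_u m) = 0"
    unfolding tr_u_def s_def[symmetric] t_def[symmetric] by (simp add: ds d(2-) awa)
  with d(1) B awa that s_def show thesis by blast
qed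

text \<open>If p divided both, it would divide S_m - S_{m-1} at \<open>tr_B\<close>, because S_{n-2}
  is prime to S_{n-1}. Then \<open>tr_B\<close> and \<open>tr_u m\<close> are both constant modulo
  p. This contradicts \<open>tr_B_linear_form_coprime\<close>, since S_{m-1}(b) and S_{m-2}(b) are
  not both zero.\<close>

lemma cheb_tr_u_coprime:
  assumes "n \<noteq> 0" "p dvd cheb (n - 1) (tr_u m)"
  shows "\<not> p dvd nonabelian_factor m n"
proof
  define c where "c = cheb m tr_B - cheb (m - 1) tr_B"
  assume "p dvd nonabelian_factor m n"
  then have "p dvd tr_awa * cheb (n - 1) (tr_u m) - c * cheb (n - 2) (tr_u m)"
    by (simp add: nonabelian_factor_def c_def)
  then have "p dvd c * cheb (n - 2) (tr_u m)"
    using assms(2) by (metis (no_types, lifting) dvd_diff dvd_mult diff_diff_eq2 add_diff_cancel_left')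
  moreover have "\<not> p dvd cheb (n - 2) (tr_u m)"
    using not_dvd_cheb_consecutive[OF assms(2)] by simp
  ultimately have "p dvd cheb m tr_B - cheb (m - 1) tr_B"
    by (simp add: c_def dvd_mult_iff)
  then obtain b where b: "p dvd tr_B - const_xyz b"
    using dvd_cheb_diff_imp_dvd_minus_const by blast
  obtain a where a: "p dvd tr_u m - const_xyz a"
    using dvd_cheb_imp_dvd_minus_const[OF assms(2)] assms(1) by auto
  have hom: "cheb k (const_xyz b) = const_xyz (cheb k b)" for k
    by (intro eval_xyz_eqI) simp
  have s: "p dvd cheb k tr_B - const_xyz (cheb k b)" for k
    using dvd_trans[OF b cheb_diff_dvd[of tr_B "const_xyz b" k]] by (simp add: hom)
  have "p dvd (tr_u m - const_xyz a) - (var_y * (cheb (m - 1) tr_B - const_xyz (cheb (m - 1) b))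
      - tr_awa * (cheb (m - 2) tr_B - const_xyz (cheb (m - 2) b)))"
    by (intro dvd_diff dvd_mult a s)
  then have "p dvd const_xyz (cheb (m - 1) b) * var_y - const_xyz (cheb (m - 2) b) * tr_awa - const_xyz a"
    by (simp add: tr_u_def algebra_simps)
  from tr_B_linear_form_coprime[OF b this] show False
    using cheb_norm[of "m - 1" b] by simp
qed

text \<open>Modulo p the norm identity leaves S_{m-2}(\<open>tr_B\<close>) = e with e = 1 or -1, so
  \<open>tr_u m\<close> becomes -e \<open>tr_awa\<close> and everything is expressed by
  \<open>tr_awa\<close> alone, unless n = -1.\<close>

lemma cheb_tr_B_coprime:
  assumes "m \<noteq> 0" "p dvd cheb (m - 1) tr_B" "p * p dvd nonabelian_factor m n"
  shows False
proof -
  define s where "s = cheb (m - 1) tr_B"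
  define t where "t = cheb (m - 2) tr_B"
  have Q: "p dvd nonabelian_factor m n" using assms(3) by (rule dvd_mult_left)
  obtain b where b: "p dvd tr_B - const_xyz b"
    using dvd_cheb_imp_dvd_minus_const[OF assms(2)] assms(1) by auto
  have c: "cheb m tr_B - cheb (m - 1) tr_B = tr_B * s - t - s"
    using cheb_rec_down[of m tr_B] by (simp add: s_def t_def)
  have norm: "s * s + t * t - tr_B * s * t = 1"
    using cheb_norm[of "m - 1" tr_B] by (simp add: s_def t_def power2_eq_square)
  have s: "p dvd s" using assms(2) by (simp add: s_def)
  have "(t - 1) * (t + 1) = s * (tr_B * t - s)"
    using norm by (simp add: algebra_simps)
  then have t: "p dvd t - 1 \<or> p dvd t + 1"
    using s by (metis dvd_mult2 dvd_mult_iff)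
  then obtain e :: poly_xyz where e: "p dvd t - e" "e = 1 \<or> e = - 1"
    by (metis diff_minus_eq_add)
  show False
  proof (cases "n = - 1")
    case False
    have u: "p dvd tr_u m - (- (e * tr_awa))"
    proof -
      have "p dvd var_y * s - tr_awa * (t - e)" by (intro dvd_diff dvd_mult e s)
      then show ?thesis by (simp add: tr_u_def s_def t_def algebra_simps)
    qed
    have ch: "p dvd cheb k (tr_u m) - cheb k (- (e * tr_awa))" for k
      using u cheb_diff_dvd by (rule dvd_trans)
    have "p dvd nonabelian_factor m n - tr_awa * (cheb (n - 1) (tr_u m) - cheb (n - 1) (- (e * tr_awa)))
       + (tr_B * s - s - (t - e)) * cheb (n - 2) (tr_u m)
       - e * (cheb (n - 2) (tr_u m) - cheb (n - 2) (- (e * tr_awa)))"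
      by (intro dvd_diff dvd_add dvd_mult dvd_mult2 Q ch e s)
    \<comment> \<open>By parity of Chebyshev polynomials this expression is
      S_n(\<open>tr_awa\<close>) up to sign, so \<open>tr_awa\<close> would be constant modulo
      p.\<close>
    then have "p dvd tr_awa * cheb (n - 1) (- (e * tr_awa)) + e * cheb (n - 2) (- (e * tr_awa))"
      by (simp add: nonabelian_factor_def c algebra_simps)
    moreover have "tr_awa * cheb (n - 1) tr_awa - cheb (n - 2) tr_awa = cheb n tr_awa"
      using cheb_rec_down[of n tr_awa] by simp
    ultimately have "p dvd cheb n tr_awa"
      using e(2) cheb_neg_arg[of "n - 1" tr_awa] cheb_neg_arg[of "n - 2" tr_awa]
      by (cases "even n") (auto simp: algebra_simps dvd_minus_iff)
    then obtain a where "p dvd tr_awa - const_xyz a"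
      using dvd_cheb_imp_dvd_minus_const False by blast
    moreover have "const_xyz 0 * var_y - const_xyz (- 1) * tr_awa - const_xyz a = tr_awa - const_xyz a"
      by (intro eval_xyz_eqI) simp
    ultimately show False using tr_B_linear_form_coprime[OF b, of 0 "- 1" a] by simp
  next
    case True
    \<comment> \<open>For n = -1 the previous reduction only yields S_{-1} = 0. Instead the norm
      identity splits off s, with q as cofactor.\<close>
    define q where "q = var_y * (tr_B * s - t - s) - tr_awa * (s - t)"
    have "nonabelian_factor m n = s * q + tr_awa * (s * s + t * t - tr_B * s * t - 1)"
      unfolding nonabelian_factor_def c
      by (simp add: True q_def tr_u_def s_def[symmetric] t_def[symmetric] cheb_reflect[of 3] cheb_1 algebra_simps)
    then have Qsq: "nonabelian_factor m n = s * q" by (simp add: norm)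
    show False
    proof (cases "p dvd q")
      case True
      \<comment> \<open>Modulo p, q is -e (y - \<open>tr_awa\<close>), a nontrivial linear
        form.\<close>
      have "p dvd - (q - (var_y * (tr_B * s - (t - e) - s) - tr_awa * (s - (t - e))))"
        by (intro dvd_diff dvd_mult e s True dvd_minus_iff[THEN iffD2])
      then have "p dvd e * (var_y - tr_awa)"
        by (simp add: q_def algebra_simps)
      then have "p dvd var_y - tr_awa" using e(2) dvd_minus_iff[of p "var_y - tr_awa"] by auto
      moreover have "const_xyz 1 * var_y - const_xyz 1 * tr_awa - const_xyz 0 = var_y - tr_awa"
        by (intro eval_xyz_eqI) simp
      ultimately show False using tr_B_linear_form_coprime[OF b, of 1 1 0] by simp
    next
      case False
      have "p * p dvd s"
        using square_dvd_mult_cancel[of q s] False assms(3) Qsq by (simp add: mult.commute)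
      obtain d where d: "derivation d" "d var_x = 1" "d var_y = 0" "d var_z = 0"
        using derivation_exists by blast
      have "d tr_B = var_y * var_z"
        by (simp add: tr_B_def derivation_simps[OF d(1)] d(2-))
      then have "\<not> p dvd d tr_B"
        using tr_B_var_y_coprime[OF b] tr_B_var_z_coprime[OF b] by (simp add: dvd_mult_iff)
      with cheb_squarefree[of "m - 1" tr_B d] \<open>p * p dvd s\<close> d(1) assms(1) show False
        by (simp add: s_def)
    qed
  qed
qed

text \<open>For m = 0 the factor is S_n(\<open>tr_awa\<close>). Otherwise the annihilating
  derivation leaves the derivative of \<open>tr_awa\<close> times S_{n-1}(\<open>tr_u m\<close>),
  and every way for p to divide this product is excluded above.\<close>

lemma nonabelian_factor_squarefree:
  assumes "p * p dvd nonabelian_factor m n"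
  shows "n = - 1 \<and> m = 0"
proof (cases "m = 0")
  case True
  have "nonabelian_factor m n = cheb n tr_awa"
    using cheb_rec_down[of n tr_awa]
    by (simp add: True nonabelian_factor_def tr_u_def cheb_0)
  with assms have sq: "p * p dvd cheb n tr_awa" by simp
  obtain d where d: "derivation d" "d var_x = 0" "d var_y = 1" "d var_z = 0"
    using derivation_exists by blast
  have "d tr_awa = - 1" by (simp add: tr_awa_def derivation_simps[OF d(1)] d(2-))
  then show ?thesis using cheb_squarefree[OF sq d(1)] not_dvd_1 True by simp
next
  case False
  have Q: "p dvd nonabelian_factor m n" using assms by (rule dvd_mult_left)
  have z: "\<not> p dvd var_z" using assms False by (rule nonabelian_factor_not_dvd_var_z)
  have s: "\<not> p dvd cheb (m - 1) tr_B" using cheb_tr_B_coprime[OF False _ assms] by blast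
  \<comment> \<open>At n = 0 the derivation would give no information: S_{-1} = 0 removes
    \<open>tr_awa\<close>, and the rest is annihilated.\<close>
  have n: "n \<noteq> 0"
  proof
    assume "n = 0"
    then have "nonabelian_factor m n = cheb m tr_B - cheb (m - 1) tr_B"
      by (simp add: nonabelian_factor_def)
    with assms cheb_diff_tr_B_squarefree show False by simp
  qed
  obtain d where d: "derivation d" "d tr_B = 0" "d (tr_u m) = 0"
    "d tr_awa = 2 * var_z ^ 2 * cheb (m - 1) tr_B"
    by (rule annihilating_derivation)
  have "d (nonabelian_factor m n) = 2 * var_z ^ 2 * cheb (m - 1) tr_B * cheb (n - 1) (tr_u m)"
    by (simp add: nonabelian_factor_def derivation_simps[OF d(1)] derivation_cheb_eq_0[OF d(1)] d(2-))
  then have "p dvd 2 * var_z ^ 2 * cheb (m - 1) tr_B * cheb (n - 1) (tr_u m)"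
    using derivation_dvd[OF d(1) assms] by simp
  then have "p dvd cheb (n - 1) (tr_u m)"
    using z s not_dvd_of_int[of 2] by (simp add: dvd_mult_iff power2_eq_square)
  then show ?thesis using cheb_tr_u_coprime[OF n] Q by blast
qed

lemma product_squarefree:
  assumes "p * p dvd abelian_factor * nonabelian_factor m n"
  shows "n = - 1 \<and> m = 0"
proof (cases "p dvd abelian_factor \<and> p dvd nonabelian_factor m n")
  case True
  then show ?thesis using factors_coprime by blast
next
  case False
  from False square_dvd_mult_cancel assms have "p * p dvd nonabelian_factor m n \<or> p * p dvd abelian_factor"
    by (metis mult.commute)
  with abelian_factor_squarefree nonabelian_factor_squarefree show ?thesis by blast
qed

end

section \<open>From squarefree generators to radical ideals\<close>

lemma dvd_power_imp_dvd_of_squarefree: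
  fixes f q :: "'a :: factorial_semiring"
  assumes "\<And>p. prime_elem p \<Longrightarrow> \<not> p * p dvd f" "f \<noteq> 0" "f dvd q ^ k"
  shows "f dvd q"
proof (cases "q = 0")
  case False
  show ?thesis
  proof (rule multiplicity_le_imp_dvd[OF assms(2)])
    fix p :: 'a assume p: "normalization_semidom_class.prime p"
    have "multiplicity p f \<le> multiplicity p q"
    proof (cases "p dvd f")
      case True
      then have "p dvd q ^ k" using assms(3) by (rule dvd_trans)
      with p have "p dvd q" by (blast intro: prime_elem_dvd_power)
      moreover have "\<not> p ^ 2 dvd f"
        using assms(1)[of p] p by (auto simp: power2_eq_square)
      then have "multiplicity p f < 2" using multiplicity_dvd'[of 2 p f] by linarith
      moreover have "multiplicity p q > 0"
        using \<open>p dvd q\<close> p False by (simp add: prime_multiplicity_gt_zero_iff)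
      ultimately show ?thesis by linarith
    qed (simp add: not_dvd_imp_multiplicity_0)
    then show "multiplicity p f \<le> multiplicity p q" .
  qed
qed simp

text \<open>This is radicality of the principal ideal. In the exceptional case the generator is 0,
  and 0 divides a power only if the base is 0, as the ring is a domain.\<close>

lemma product_dvd_power_imp_dvd:
  assumes "abelian_factor * nonabelian_factor m n dvd q ^ k"
  shows "abelian_factor * nonabelian_factor m n dvd q"
proof (cases "n = - 1 \<and> m = 0")
  case True
  then have "nonabelian_factor m n = 0"
    by (simp add: nonabelian_factor_def tr_u_def cheb_reflect[of 3] cheb_0 cheb_1)
  then have "abelian_factor * nonabelian_factor m n = 0" by (simp only: mult_zero_right)
  with assms show ?thesis by (simp del: mult_eq_0_iff)
next
  case False
  then have 1: "\<not> p * p dvd abelian_factor * nonabelian_factor m n" if "prime_elem p" for p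
    using product_squarefree[OF that] by blast
  \<comment> \<open>Every square divides 0, so squarefreeness at a single prime, here z, shows that
    the product is nonzero.\<close>
  have "prime_elem var_z"
    unfolding var_z_def by (rule prime_elem_linear_poly) simp_all
  have 0: "abelian_factor * nonabelian_factor m n \<noteq> 0"
  proof
    assume "abelian_factor * nonabelian_factor m n = 0"
    with 1[OF \<open>prime_elem var_z\<close>] show False by (simp only: dvd_0_right not_True_eq_False)
  qed
  show ?thesis by (rule dvd_power_imp_dvd_of_squarefree[OF 1 0 assms])
qed

section \<open>Homomorphisms from presented groups\<close>

lemma word_value_simps [simp]:
  "word_value G f [] = \<one>\<^bsub>G\<^esub>"
  "word_value G f ((g, e) # u) = (if e then f g else inv\<^bsub>G\<^esub> (f g)) \<otimes>\<^bsub>G\<^esub> word_value G f u"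
  by (simp_all add: word_value_def)

lemma inv_word_simps [simp]:
  "inv_word [] = []" "inv_word (x # u) = inv_word u @ [(fst x, \<not> snd x)]"
  by (simp_all add: inv_word_def split_beta)

context group
begin

lemma word_value_closed [simp]:
  assumes "range f \<subseteq> carrier G"
  shows "word_value G f u \<in> carrier G"
proof -
  have "f g \<in> carrier G" for g using assms by auto
  then show ?thesis by (induction u) auto
qed

lemma word_value_append:
  assumes "range f \<subseteq> carrier G"
  shows "word_value G f (u @ v) = word_value G f u \<otimes> word_value G f v"
proof (induction u)
  case (Cons x u)
  have "f g \<in> carrier G" for g using assms by auto
  with Cons assms show ?case by (cases x) (simp add: m_assoc)
qed (simp add: assms)

lemma word_value_word_eq:
  assumes "word_eq R u v" "range f \<subseteq> carrier G"
    and "\<And>l r. (l, r) \<in> R \<Longrightarrow> word_value G f l = word_value G f r"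
  shows "word_value G f u = word_value G f v"
  using assms(1)
proof induction
  case (word_eq_cancel g e)
  have "f g \<in> carrier G" using assms(2) by auto
  then show ?case by simp
qed (simp_all add: word_value_append assms)

lemma word_value_inv_word:
  assumes "range f \<subseteq> carrier G"
  shows "word_value G f (inv_word u) = inv (word_value G f u)"
proof -
  have "word_value G f (inv_word u) \<otimes> word_value G f u = \<one>"
    using word_value_word_eq[OF inv_word_cancel(2)[of "{}" u] assms]
    by (simp add: word_value_append assms)
  then show ?thesis by (simp add: assms inv_equality)
qed

text \<open>The map of the universal property of a presentation. It is read off an arbitrary word of
  the class; \<open>word_value_word_eq\<close> makes the choice immaterial once the relations hold
  in the target.\<close>

definition presented_hom :: "('g \<Rightarrow> 'a) \<Rightarrow> 'g word set \<Rightarrow> 'a" where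
  "presented_hom f S = word_value G f (SOME u. u \<in> S)"

lemma presented_hom:
  assumes "range f \<subseteq> carrier G"
    and "\<And>l r. (l, r) \<in> R \<Longrightarrow> word_value G f l = word_value G f r"
  shows presented_hom_word_class: "presented_hom f (word_class R u) = word_value G f u"
    and presented_hom_hom: "presented_hom f \<in> hom (presented_group R) G"
proof -
  show 1: "presented_hom f (word_class R u) = word_value G f u" for u
  proof -
    have "word_eq R u (SOME v. v \<in> word_class R u)"
      by (rule someI2[of _ u]) (auto simp: word_class_def word_eq_refl)
    then show ?thesis
      unfolding presented_hom_def using word_value_word_eq assms by metis
  qed
  show "presented_hom f \<in> hom (presented_group R) G"
  proof (rule homI)
    fix S T assume "S \<in> carrier (presented_group R)" "T \<in> carrier (presented_group R)"
    then obtain u v where "S = word_class R u" "T = word_class R v"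
      by (auto simp: presented_group_def)
    then show "presented_hom f (S \<otimes>\<^bsub>presented_group R\<^esub> T) = presented_hom f S \<otimes> presented_hom f T"
      by (simp add: word_class_append 1 word_value_append assms)
  qed (auto simp: presented_hom_def assms)
qed

lemma word_value_eq_hom:
  assumes "\<phi> \<in> hom G H" "Group.group H" "range f \<subseteq> carrier G"
  shows "\<phi> (word_value G f u) = word_value H (\<lambda>g. \<phi> (f g)) u"
proof -
  interpret H: Group.group H by (rule assms(2))
  interpret group_hom G H \<phi> by unfold_locales (rule assms(1))
  have "f g \<in> carrier G" for g using assms(3) by auto
  then show ?thesis using assms(3) by (induction u) auto
qed

end

lemma word_value_presented_group:
  "word_value (presented_group R) (\<lambda>g. word_class R [(g, True)]) u = word_class R u"
proof (induction u)
  case (Cons x u)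
  obtain g e where x: "x = (g, e)" by force
  have "(if e then word_class R [(g, True)] else inv\<^bsub>presented_group R\<^esub> word_class R [(g, True)])
      = word_class R [x]"
    by (simp add: x word_class_inv[symmetric])
  then have "word_value (presented_group R) (\<lambda>g. word_class R [(g, True)]) (x # u)
      = word_class R [x] \<otimes>\<^bsub>presented_group R\<^esub> word_class R u"
    by (simp add: x Cons.IH)
  then show ?case by (simp add: word_class_append)
qed (simp add: one_presented_group)

lemma hom_presented_group_word_class:
  assumes "\<rho> \<in> hom (presented_group R) G" "group G"
  shows "\<rho> (word_class R u) = word_value G (\<lambda>g. \<rho> (word_class R [(g, True)])) u"
proof -
  have "range (\<lambda>g. word_class R [(g, True)]) \<subseteq> carrier (presented_group R)" by auto
  from group.word_value_eq_hom[OF presented_group_is_group assms this, of u]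
  show ?thesis unfolding word_value_presented_group .
qed

section \<open>Trace polynomials\<close>

lemmas mat2_simps = vec_eq_iff forall_2 matrix_matrix_mult_def sum_2 mat_def trace_def det_2

lemma SL2C_simps [simp]:
  "A \<in> carrier SL2C \<longleftrightarrow> det A = 1" "A \<otimes>\<^bsub>SL2C\<^esub> B = A ** B" "\<one>\<^bsub>SL2C\<^esub> = mat 1"
  by (simp_all add: SL2C_def)

lemma Cayley_Hamilton_2:
  fixes A :: "complex^2^2"
  assumes "det A = 1"
  shows "(A ** A) $ i $ j = trace A * A $ i $ j - mat 1 $ i $ j"
  using assms exhaust_2[of i] exhaust_2[of j] by (auto simp: mat2_simps algebra_simps)

definition adjugate_2 :: "complex^2^2 \<Rightarrow> complex^2^2" where
  "adjugate_2 A = (\<chi> i j. trace A * mat 1 $ i $ j - A $ i $ j)"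

lemma adjugate_2:
  assumes "det A = 1"
  shows "A ** adjugate_2 A = mat 1" "adjugate_2 A ** A = mat 1" "det (adjugate_2 A) = 1"
  using assms by (auto simp: adjugate_2_def mat2_simps algebra_simps)

lemma group_SL2C: "group SL2C"
proof (rule groupI)
  fix A assume "A \<in> carrier SL2C"
  then show "\<exists>B\<in>carrier SL2C. B \<otimes>\<^bsub>SL2C\<^esub> A = \<one>\<^bsub>SL2C\<^esub>"
    using adjugate_2[of A] by (intro bexI[of _ "adjugate_2 A"]) auto
qed (simp_all add: det_mul matrix_mul_assoc)

lemma inv_SL2C:
  assumes "det A = 1"
  shows "inv\<^bsub>SL2C\<^esub> A = adjugate_2 A"
  using adjugate_2[OF assms] by (intro group.inv_equality[OF group_SL2C]) (simp_all add: assms)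

section \<open>Words in two matrices as combinations of 1, A, W, A W\<close>

abbreviation mat_eval :: "complex^2^2 \<Rightarrow> complex^2^2 \<Rightarrow> letter word \<Rightarrow> complex^2^2" where
  "mat_eval A W \<equiv> word_value SL2C (case_letter A W)"

lemma range_case_letter: "range (case_letter a w) = {a, w}"
  by (auto simp: image_iff split: letter.splits)

type_synonym coords = "poly_xyz \<times> poly_xyz \<times> poly_xyz \<times> poly_xyz"

text \<open>Coordinates are taken with respect to \<open>1, A, W, A W\<close>.\<close>

fun lmult :: "letter \<Rightarrow> coords \<Rightarrow> coords" where
  "lmult A_letter (p, q, r, s) = (- q, p + var_x * q, - s, r + var_x * s)"
| "lmult W_letter (p, q, r, s) =
     (q * (var_z - var_x * var_y) - r - var_x * s, var_y * q + s,
      p + var_x * q + var_y * r + var_z * s, - q)"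

text \<open>By Cayley-Hamilton the inverse of a matrix M in SL_2 is trace M minus M.\<close>

fun lmult_inv :: "letter \<Rightarrow> coords \<Rightarrow> coords" where
  "lmult_inv g (p, q, r, s) =
     (let (p', q', r', s') = lmult g (p, q, r, s); t = case_letter var_x var_y g
      in (t * p - p', t * q - q', t * r - r', t * s - s'))"

primrec coords :: "letter word \<Rightarrow> coords" where
  "coords [] = (1, 0, 0, 0)"
| "coords (x # u) = (if snd x then lmult (fst x) else lmult_inv (fst x)) (coords u)"

definition lin_comb :: "complex^2^2 \<Rightarrow> complex^2^2 \<Rightarrow> coords \<Rightarrow> complex^2^2" where
  "lin_comb A W c = (case c of (p, q, r, s) \<Rightarrow>
     let e = \<lambda>t. eval_xyz t (trace A) (trace W) (trace (A ** W))
     in \<chi> i j. e p * mat 1 $ i $ j + e q * A $ i $ j + e r * W $ i $ j + e s * (A ** W) $ i $ j)"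

text \<open>The polarized Cayley-Hamilton identity, which brings W A into the basis 1, A, W, A
  W.\<close>

lemma mult_swap:
  fixes A W :: "complex^2^2"
  shows "(W ** A) $ i $ j = - (A ** W) $ i $ j + trace A * W $ i $ j + trace W * A $ i $ j
    + (trace (A ** W) - trace A * trace W) * mat 1 $ i $ j"
  using exhaust_2[of i] exhaust_2[of j] by (auto simp: mat2_simps algebra_simps)

lemma mult_A_A_W:
  fixes A W :: "complex^2^2"
  assumes "det A = 1"
  shows "(A ** (A ** W)) $ i $ j = trace A * (A ** W) $ i $ j - W $ i $ j"
proof -
  have "(A ** (A ** W)) $ i $ j = (\<Sum>k\<in>UNIV. (A ** A) $ i $ k * W $ k $ j)"
    unfolding matrix_mul_assoc by (simp add: matrix_matrix_mult_def)
  also have "\<dots> = (\<Sum>k\<in>UNIV. (trace A * A $ i $ k - mat 1 $ i $ k) * W $ k $ j)"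
    by (simp only: Cayley_Hamilton_2[OF assms])
  also have "\<dots> = trace A * (A ** W) $ i $ j - (mat 1 ** W) $ i $ j"
    by (simp add: matrix_matrix_mult_def sum_2 algebra_simps)
  finally show ?thesis by simp
qed

lemma mult_W_A_W:
  fixes A W :: "complex^2^2"
  assumes "det W = 1"
  shows "(W ** (A ** W)) $ i $ j = A $ i $ j + trace (A ** W) * W $ i $ j - trace A * mat 1 $ i $ j"
proof -
  \<comment> \<open>Swapping the inner product A W puts the two factors W next to each other, where
    Cayley-Hamilton applies.\<close>
  have "(W ** (A ** W)) $ i $ j = - (W ** (W ** A)) $ i $ j + trace W * (W ** A) $ i $ j
      + trace A * (W ** W) $ i $ j + (trace (A ** W) - trace A * trace W) * W $ i $ j"
  proof -
    have "(W ** (A ** W)) $ i $ j = (\<Sum>k\<in>UNIV. W $ i $ k * (A ** W) $ k $ j)"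
      by (simp add: matrix_matrix_mult_def)
    also have "\<dots> = (\<Sum>k\<in>UNIV. W $ i $ k * (- (W ** A) $ k $ j + trace W * A $ k $ j
        + trace A * W $ k $ j + (trace (A ** W) - trace A * trace W) * mat 1 $ k $ j))"
      using mult_swap[where A = W and W = A] unfolding trace_mul_sym[of W A]
      by (simp only: mult.commute[of "trace W" "trace A"])
    also have "\<dots> = - (W ** (W ** A)) $ i $ j + trace W * (W ** A) $ i $ j
      + trace A * (W ** W) $ i $ j + (trace (A ** W) - trace A * trace W) * W $ i $ j"
      using exhaust_2[of j]
      by (auto simp: matrix_matrix_mult_def[of W] sum_2 mat_def algebra_simps)
    finally show ?thesis .
  qed
  then show ?thesis
    by (simp add: mult_A_A_W[OF assms] Cayley_Hamilton_2[OF assms] algebra_simps)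
qed

lemma mult_lin_comb:
  "(M ** lin_comb A W (p, q, r, s)) $ i $ j =
     (let e = \<lambda>t. eval_xyz t (trace A) (trace W) (trace (A ** W))
      in e p * M $ i $ j + e q * (M ** A) $ i $ j + e r * (M ** W) $ i $ j + e s * (M ** (A ** W)) $ i $ j)"
  using exhaust_2[of j]
  by (auto simp: matrix_matrix_mult_def[of M] lin_comb_def Let_def sum_2 mat_def algebra_simps)

lemma lin_comb_lmult:
  assumes "det A = 1" "det W = 1"
  shows "lin_comb A W (lmult A_letter c) = A ** lin_comb A W c"
    and "lin_comb A W (lmult W_letter c) = W ** lin_comb A W c"
proof -
  obtain p q r s where c: "c = (p, q, r, s)" by (metis prod_cases4)
  show "lin_comb A W (lmult A_letter c) = A ** lin_comb A W c"
    by (simp add: c vec_eq_iff mult_lin_comb)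
       (simp add: lin_comb_def Let_def Cayley_Hamilton_2 mult_A_A_W assms algebra_simps)
  show "lin_comb A W (lmult W_letter c) = W ** lin_comb A W c"
    by (simp add: c vec_eq_iff mult_lin_comb)
       (simp add: lin_comb_def Let_def Cayley_Hamilton_2 mult_swap[where A = A and W = W] mult_W_A_W assms algebra_simps)
qed

lemma lin_comb_lmult_inv:
  assumes "det A = 1" "det W = 1"
  shows "lin_comb A W (lmult_inv g c) = adjugate_2 (case_letter A W g) ** lin_comb A W c"
proof -
  obtain p q r s where c: "c = (p, q, r, s)" by (metis prod_cases4)
  obtain p' q' r' s' where l: "lmult g c = (p', q', r', s')" by (metis prod_cases4)
  define M where "M = case_letter A W g"
  have "M ** lin_comb A W c = lin_comb A W (p', q', r', s')"
    unfolding M_def l[symmetric] by (cases g) (simp_all add: lin_comb_lmult[OF assms])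
  moreover have "(adjugate_2 M ** N) $ i $ j = trace M * N $ i $ j - (M ** N) $ i $ j" for N :: "complex^2^2" and i j
    using exhaust_2[of i] exhaust_2[of j] by (auto simp: adjugate_2_def mat2_simps algebra_simps)
  moreover have "trace M = eval_xyz (case_letter var_x var_y g) (trace A) (trace W) (trace (A ** W))"
    by (cases g) (simp_all add: M_def)
  ultimately show ?thesis
    unfolding M_def[symmetric] using l
    by (simp add: vec_eq_iff c Let_def) (simp add: lin_comb_def Let_def algebra_simps)
qed

lemma mat_eval_eq_lin_comb:
  assumes "det A = 1" "det W = 1"
  shows "mat_eval A W u = lin_comb A W (coords u)"
proof (induction u)
  case Nil
  show ?case by (simp add: lin_comb_def vec_eq_iff)
next
  case (Cons x u)
  obtain g e where x: "x = (g, e)" by force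
  show ?case
  proof (cases e)
    case True
    then show ?thesis
      using Cons.IH by (cases g) (simp_all add: x lin_comb_lmult[OF assms])
  next
    case False
    then show ?thesis
      using Cons.IH assms by (cases g) (simp_all add: x lin_comb_lmult_inv[OF assms] inv_SL2C)
  qed
qed

definition coords_trace :: "coords \<Rightarrow> poly_xyz" where
  "coords_trace c = (case c of (p, q, r, s) \<Rightarrow> 2 * p + var_x * q + var_y * r + var_z * s)"

lemma trace_lin_comb:
  "trace (lin_comb A W c) = eval_xyz (coords_trace c) (trace A) (trace W) (trace (A ** W))"
  by (cases c) (simp add: lin_comb_def coords_trace_def trace_def sum_2 mat_def algebra_simps)

text \<open>Makes identities in C[x, y, z] testable on matrices, and trace polynomials unique. A is
  upper and W lower triangular with the required eigenvalues; the lower left entry of W adjusts the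
  trace of A W.\<close>

lemma traces_realized:
  obtains A W :: "complex^2^2"
  where "det A = 1" "det W = 1" "trace A = x" "trace W = y" "trace (A ** W) = z"
proof -
  have root: "\<exists>t. t \<noteq> 0 \<and> t + 1 / t = x" for x :: complex
  proof -
    obtain t where t: "poly [:1, - x, 1:] t = 0"
      using fundamental_theorem_of_algebra_alt[of "[:1, - x, 1:]"] by auto
    then have "t \<noteq> 0" by auto
    with t show ?thesis by (intro exI[of _ t]) (simp add: field_simps power2_eq_square)
  qed
  obtain s where s: "s \<noteq> 0" "s + 1 / s = x" using root by blast
  obtain t where t: "t \<noteq> 0" "t + 1 / t = y" using root by blast
  define A :: "complex^2^2" where "A = vector [vector [s, 1], vector [0, 1 / s]]"
  define W :: "complex^2^2" where
    "W = vector [vector [t, 0], vector [z - s * t - 1 / (s * t), 1 / t]]"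
  show thesis
    by (rule that[of A W])
       (use s t in \<open>simp_all add: A_def W_def det_2 trace_def sum_2 matrix_matrix_mult_def\<close>)
qed

text \<open>Turns the definite description into a computable recursion. Existence is the expansion
  in 1, A, W, A W; uniqueness holds because every pair in SL_2 comes from a representation of the
  free group.\<close>

lemma trace_poly_eq_coords_trace: "trace_poly u = coords_trace (coords u)"
proof -
  let ?P = "\<lambda>P. \<forall>\<rho>\<in>hom free_group_aw SL2C. trace (\<rho> (free_class u)) =
       eval_xyz P (trace (\<rho> (free_class letter_a))) (trace (\<rho> (free_class letter_w)))
         (trace (\<rho> (free_class (letter_a @ letter_w))))"
  have "?P (coords_trace (coords u))"
  proof
    fix \<rho> assume \<rho>: "\<rho> \<in> hom free_group_aw SL2C"
    define A where "A = \<rho> (free_class letter_a)"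
    define W where "W = \<rho> (free_class letter_w)"
    have det: "det A = 1" "det W = 1"
      using hom_in_carrier[OF \<rho>, of "free_class letter_a"] hom_in_carrier[OF \<rho>, of "free_class letter_w"]
      by (auto simp: A_def W_def)
    have "(\<lambda>g. \<rho> (free_class [(g, True)])) = case_letter A W"
      by (auto simp: A_def W_def split: letter.splits)
    then have val: "\<rho> (free_class v) = mat_eval A W v" for v
      using hom_presented_group_word_class[OF \<rho> group_SL2C, of v] by simp
    show "trace (\<rho> (free_class u)) = eval_xyz (coords_trace (coords u)) (trace (\<rho> (free_class letter_a)))
        (trace (\<rho> (free_class letter_w))) (trace (\<rho> (free_class (letter_a @ letter_w))))"
      using det by (simp add: val mat_eval_eq_lin_comb[of A W u] trace_lin_comb)
  qed
  moreover have "P = coords_trace (coords u)" if P: "?P P" for P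
  proof (rule eval_xyz_eqI)
    fix x y z
    obtain A W :: "complex^2^2" where AW: "det A = 1" "det W = 1" "trace A = x" "trace W = y"
      "trace (A ** W) = z"
      by (rule traces_realized)
    have carr: "range (case_letter A W) \<subseteq> carrier SL2C"
      using AW by (simp add: range_case_letter)
    let ?\<rho> = "group.presented_hom SL2C (case_letter A W)"
    have "?\<rho> \<in> hom free_group_aw SL2C" and "?\<rho> (free_class v) = mat_eval A W v" for v
      using group.presented_hom[OF group_SL2C carr, of "{}"] by auto
    with P AW have "trace (mat_eval A W u) = eval_xyz P x y z" by auto
    then show "eval_xyz P x y z = eval_xyz (coords_trace (coords u)) x y z"
      using AW by (simp add: mat_eval_eq_lin_comb[of A W u] trace_lin_comb)
  qed
  ultimately show ?thesis unfolding trace_poly_def by (rule the_equality)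
qed

lemma trace_mat_eval:
  assumes "det A = 1" "det W = 1"
  shows "trace (mat_eval A W u) = eval_xyz (trace_poly u) (trace A) (trace W) (trace (A ** W))"
  by (simp add: trace_poly_eq_coords_trace mat_eval_eq_lin_comb assms trace_lin_comb)

lemma poly_xyz_eqI:
  assumes "\<And>A W :: complex^2^2. det A = 1 \<Longrightarrow> det W = 1 \<Longrightarrow>
    eval_xyz p (trace A) (trace W) (trace (A ** W)) = eval_xyz q (trace A) (trace W) (trace (A ** W))"
  shows "p = q"
proof (rule eval_xyz_eqI)
  fix x y z
  obtain A W :: "complex^2^2" where "det A = 1" "det W = 1" "trace A = x" "trace W = y"
    "trace (A ** W) = z"
    by (rule traces_realized)
  then show "eval_xyz p x y z = eval_xyz q x y z" using assms[of A W] by simp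
qed

section \<open>Identities between trace polynomials\<close>

context
  fixes A W :: "complex^2^2"
  assumes det: "det A = 1" "det W = 1"
begin

lemma range_mat_pair: "range (case_letter A W) \<subseteq> carrier SL2C"
  by (simp add: range_case_letter det)

lemma mat_eval_append: "mat_eval A W (u @ v) = mat_eval A W u ** mat_eval A W v"
  using group.word_value_append[OF group_SL2C range_mat_pair] by simp

lemma det_mat_eval: "det (mat_eval A W u) = 1"
  using group.word_value_closed[OF group_SL2C range_mat_pair] by simp

lemma mat_eval_inv_word: "mat_eval A W (inv_word u) = adjugate_2 (mat_eval A W u)"
  using group.word_value_inv_word[OF group_SL2C range_mat_pair] by (simp add: inv_SL2C det_mat_eval)

end

lemma matrix_adjugate_2_transpose: "adjugate_2 (transpose A) = transpose (adjugate_2 A)"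
  by (simp add: adjugate_2_def mat2_simps transpose_def)

lemma trace_transpose: "trace (transpose A) = trace A"
  by (simp add: trace_def transpose_def)

text \<open>Transposition reverses products and commutes with inversion, so it realizes reversal of
  words.\<close>

lemma mat_eval_rev:
  assumes "det A = 1" "det W = 1"
  shows "mat_eval (transpose A) (transpose W) (rev u) = transpose (mat_eval A W u)"
proof (induction u)
  case Nil
  show ?case by (simp add: transpose_mat)
next
  case (Cons x u)
  obtain g e where x: "x = (g, e)" by force
  have det: "det (transpose A) = 1" "det (transpose W) = 1" using assms by simp_all
  have "mat_eval (transpose A) (transpose W) [x] = transpose (mat_eval A W [x])"
    using assms by (cases g) (simp_all add: x inv_SL2C matrix_adjugate_2_transpose)
  moreover have "mat_eval A W (x # u) = mat_eval A W [x] ** mat_eval A W u"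
    using mat_eval_append[OF assms, of "[x]" u] by simp
  ultimately show ?case
    by (simp add: mat_eval_append[OF det] Cons.IH matrix_transpose_mul del: word_value_simps)
qed

lemma trace_poly_eqI:
  assumes "\<And>A W. det A = 1 \<Longrightarrow> det W = 1 \<Longrightarrow> trace (mat_eval A W u) = trace (mat_eval A W v)"
  shows "trace_poly u = trace_poly v"
  using assms by (intro poly_xyz_eqI) (simp add: trace_mat_eval[symmetric])

lemma trace_poly_word_eq:
  assumes "word_eq {} u v"
  shows "trace_poly u = trace_poly v"
  by (rule trace_poly_eqI, subst group.word_value_word_eq[OF group_SL2C assms range_mat_pair]) simp_all

lemma trace_poly_commute: "trace_poly (u @ v) = trace_poly (v @ u)"
  by (rule trace_poly_eqI) (simp only: mat_eval_append trace_mul_sym[of "mat_eval _ _ u"])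

text \<open>Transposing both matrices preserves the three coordinates x, y, z, and hence every trace
  polynomial.\<close>

lemma trace_poly_rev: "trace_poly (rev u) = trace_poly u"
proof (rule poly_xyz_eqI)
  fix A W :: "complex^2^2" assume det: "det A = 1" "det W = 1"
  then have det': "det (transpose A) = 1" "det (transpose W) = 1" by simp_all
  have "trace (transpose A ** transpose W) = trace (A ** W)"
    by (metis matrix_transpose_mul trace_transpose trace_mul_sym)
  then show "eval_xyz (trace_poly (rev u)) (trace A) (trace W) (trace (A ** W)) =
      eval_xyz (trace_poly u) (trace A) (trace W) (trace (A ** W))"
    using trace_mat_eval[OF det', of "rev u"] trace_mat_eval[OF det, of u] mat_eval_rev[OF det, of u]
    by (simp add: trace_transpose)
qed

text \<open>Cayley-Hamilton inside a trace; it is the source of the recurrence for powers of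
  words.\<close>

lemma trace_poly_inv_word:
  "trace_poly (g @ inv_word v @ h) = trace_poly v * trace_poly (g @ h) - trace_poly (g @ v @ h)"
proof (rule poly_xyz_eqI)
  fix A W :: "complex^2^2" assume det: "det A = 1" "det W = 1"
  have "trace (G ** (adjugate_2 V ** H)) = trace V * trace (G ** H) - trace (G ** (V ** H))"
    for G V H :: "complex^2^2"
    by (simp add: adjugate_2_def mat2_simps algebra_simps)
  then show "eval_xyz (trace_poly (g @ inv_word v @ h)) (trace A) (trace W) (trace (A ** W)) =
      eval_xyz (trace_poly v * trace_poly (g @ h) - trace_poly (g @ v @ h)) (trace A) (trace W) (trace (A ** W))"
    by (simp add: trace_mat_eval[OF det, symmetric] mat_eval_append[OF det] mat_eval_inv_word[OF det])
qed

lemma word_eq_word_pow_add: "word_eq R (word_pow v (j + k)) (word_pow v j @ word_pow v k)"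
proof -
  interpret group "presented_group R" by (rule presented_group_is_group)
  show ?thesis
    unfolding word_class_eq_iff[symmetric]
    by (simp add: word_class_append[symmetric] word_class_pow int_pow_mult)
qed

lemma word_pow_simps [simp]: "word_pow v 0 = []" "word_pow v 1 = v" "word_pow v (- 1) = inv_word v"
  by (simp_all add: word_pow_def)

text \<open>In SL_2 one has V^k = S_{k-1} V - S_{k-2} with S_j taken at trace V, for negative k as
  well: the traces in context satisfy the Chebyshev recurrence in k.\<close>

lemma trace_poly_word_pow:
  "trace_poly (g @ word_pow v k @ h) =
     cheb (k - 1) (trace_poly v) * trace_poly (g @ v @ h) - cheb (k - 2) (trace_poly v) * trace_poly (g @ h)"
proof -
  let ?t = "trace_poly v"
  define F where "F k = trace_poly (g @ word_pow v k @ h)" for k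
  have ctx: "trace_poly (g @ u @ h) = trace_poly (g @ u' @ h)" if "word_eq {} u u'" for u u'
    using that by (intro trace_poly_word_eq word_eq_append word_eq_refl)
  have "F k = F 0 * cheb k ?t - F (- 1) * cheb (k - 1) ?t"
  proof (rule cheb_rec_unique)
    fix k
    have "F (k - 1) = trace_poly ((g @ word_pow v k) @ inv_word v @ h)"
      using ctx[OF word_eq_word_pow_add[of "{}" v k "- 1"]] by (simp add: F_def)
    moreover have "F (k + 1) = trace_poly ((g @ word_pow v k) @ v @ h)"
      using ctx[OF word_eq_word_pow_add[of "{}" v k 1]] by (simp add: F_def)
    ultimately show "F (k + 1) = ?t * F k - F (k - 1)"
      using trace_poly_inv_word[of "g @ word_pow v k" v h] by (simp add: F_def)
  qed
  also have "F (- 1) = ?t * F 0 - trace_poly (g @ v @ h)"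
    by (simp add: F_def trace_poly_inv_word)
  finally show ?thesis
    unfolding cheb_rec_down[of k ?t] by (simp add: F_def algebra_simps)
qed

lemma trace_poly_append_coords:
  assumes "coords g = (p, q, r, s)"
  shows "trace_poly (u @ g) = p * trace_poly u + q * trace_poly (u @ letter_a)
    + r * trace_poly (u @ letter_w) + s * trace_poly (u @ letter_a @ letter_w)"
proof (rule poly_xyz_eqI)
  fix A W :: "complex^2^2" assume det: "det A = 1" "det W = 1"
  let ?e = "\<lambda>t. eval_xyz t (trace A) (trace W) (trace (A ** W))"
  let ?U = "mat_eval A W u"
  have "trace (?U ** lin_comb A W (p, q, r, s))
      = ?e p * trace ?U + ?e q * trace (?U ** A) + ?e r * trace (?U ** W) + ?e s * trace (?U ** (A ** W))"
    unfolding trace_def[of "?U ** lin_comb A W (p, q, r, s)"] sum_2 mult_lin_comb Let_def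
    by (simp add: trace_def sum_2 algebra_simps)
  then show "?e (trace_poly (u @ g)) = ?e (p * trace_poly u + q * trace_poly (u @ letter_a)
    + r * trace_poly (u @ letter_w) + s * trace_poly (u @ letter_a @ letter_w))"
    using mat_eval_append[OF det, of u letter_a] mat_eval_append[OF det, of u letter_w]
      mat_eval_append[OF det, of u "letter_a @ letter_w"] mat_eval_append[OF det, of u g]
      mat_eval_eq_lin_comb[OF det, of g]
    by (simp add: trace_mat_eval[OF det, symmetric] assms)
qed

section \<open>The trace polynomials of the two-generator presentation\<close>

abbreviation word_B :: "letter word" where
  "word_B \<equiv> letter_a @ letter_w @ letter_a @ inv_word letter_w"

abbreviation word_K :: "letter word" where
  "word_K \<equiv> letter_a @ letter_w @ letter_a @ inv_word letter_w @ inv_word letter_a"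

lemmas trace_poly_code = trace_poly_eq_coords_trace coords_trace_def

lemma trace_poly_generators [simp]:
  "trace_poly [] = 2" "trace_poly letter_a = var_x" "trace_poly letter_w = var_y"
  "trace_poly (letter_a @ letter_w) = var_z"
  by (simp_all add: trace_poly_code)

lemma trace_poly_word_B: "trace_poly word_B = tr_B"
  by (simp add: trace_poly_code tr_B_def algebra_simps power2_eq_square)

lemma trace_poly_word_u: "trace_poly (word_u m) = tr_u m"
proof -
  have "trace_poly (word_B @ letter_w) = tr_awa"
    by (simp add: trace_poly_code tr_awa_def algebra_simps power2_eq_square)
  \<comment> \<open>The exponent 1 - m produces S_{-m} and S_{-m-1}, which reflection turns into
    -S_{m-2} and -S_{m-1}.\<close>
  then show ?thesis
    using trace_poly_word_pow[of "[]" word_B "1 - m" letter_w] cheb_reflect[of m tr_B] cheb_reflect[of "m + 1" tr_B]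
    unfolding trace_poly_word_B word_u_def by (simp add: tr_u_def algebra_simps)
qed

lemma rev_inv_word: "rev (inv_word u) = inv_word (rev u)"
  by (simp add: inv_word_def rev_map)

lemma rev_word_pow: "rev (word_pow u k) = word_pow (rev u) k"
proof -
  have "rev (concat (replicate j v)) = concat (replicate j (rev v))" for j and v :: "'a word"
    by (simp add: rev_concat)
  then show ?thesis by (simp add: word_pow_def rev_inv_word)
qed

definition defining_poly :: "int \<Rightarrow> int \<Rightarrow> poly_xyz" where
  "defining_poly m n = trace_poly (word_r m n @ letter_a @ letter_w)
     - trace_poly (rev (word_r m n) @ letter_a @ letter_w)"

lemma trace_poly_word_u_context:
  "trace_poly (g @ word_u m @ h) = cheb (m - 1) tr_B * trace_poly (g @ letter_w @ h)
     - cheb (m - 2) tr_B * trace_poly (g @ word_B @ letter_w @ h)"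
  "trace_poly (g @ rev (word_u m) @ h) = cheb (m - 1) tr_B * trace_poly (g @ letter_w @ h)
     - cheb (m - 2) tr_B * trace_poly (g @ letter_w @ rev word_B @ h)"
  using trace_poly_word_pow[of g word_B "1 - m" "letter_w @ h"]
    trace_poly_word_pow[of "g @ letter_w" "rev word_B" "1 - m" "h"]
    cheb_reflect[of m tr_B] cheb_reflect[of "m + 1" tr_B]
  unfolding trace_poly_rev trace_poly_word_B
  unfolding word_u_def rev_append rev_word_pow
  by (simp_all add: algebra_simps)

lemma trace_poly_cancel: "trace_poly (g @ [(x, e), (x, \<not> e)] @ h) = trace_poly (g @ h)"
  using trace_poly_word_eq[OF word_eq_append[OF word_eq_refl[of _ g] word_eq_append[OF word_eq_cancel[of _ x e] word_eq_refl[of _ h]]]]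
  by simp

text \<open>In the first three words cancellation leaves a w a and, up to cyclic order, the squares
  of a w and a w a. The last three belong to the reversed word; each differs from its counterpart by
  a multiple of \<open>abelian_factor\<close>, which is how that factor arises.\<close>

lemma concrete_traces:
  fixes awa :: "letter word"
  defines "awa \<equiv> letter_a @ letter_w @ letter_a"
  shows "trace_poly (word_K @ letter_a @ letter_w) = tr_awa"
    and "trace_poly (letter_w @ word_K @ letter_a @ letter_w) = var_z ^ 2 - 2"
    and "trace_poly (word_B @ letter_w @ word_K @ letter_a @ letter_w) = tr_awa ^ 2 - 2"
    and "trace_poly (rev word_K @ letter_a @ letter_w) = tr_awa * (1 - abelian_factor)"
    and "trace_poly (rev word_K @ letter_w @ letter_a @ letter_w) =
      var_z ^ 2 - 2 - (var_z ^ 2 - 1) * abelian_factor"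
    and "trace_poly (rev word_K @ letter_w @ rev word_B @ letter_a @ letter_w) =
      tr_awa ^ 2 - 2 - (tr_awa ^ 2 - 1) * abelian_factor"
proof -
  have w: "trace_poly awa = tr_awa"
    by (simp add: trace_poly_code tr_awa_def awa_def algebra_simps)
  have "trace_poly (word_K @ letter_a @ letter_w) = trace_poly awa"
    using trace_poly_cancel[of "letter_a @ letter_w @ letter_a @ inv_word letter_w" A_letter False letter_w]
      trace_poly_cancel[of "letter_a @ letter_w @ letter_a" W_letter False "[]"]
    by (simp add: awa_def)
  with w show "trace_poly (word_K @ letter_a @ letter_w) = tr_awa" by simp
  show "trace_poly (letter_w @ word_K @ letter_a @ letter_w) = var_z ^ 2 - 2"
    using trace_poly_cancel[of "letter_w @ letter_a @ letter_w @ letter_a @ inv_word letter_w" A_letter False letter_w]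
      trace_poly_cancel[of "letter_w @ letter_a @ letter_w @ letter_a" W_letter False "[]"]
    by (simp add: trace_poly_code algebra_simps power2_eq_square)
  have "trace_poly (word_B @ letter_w @ word_K @ letter_a @ letter_w) = trace_poly (awa @ awa)"
    using trace_poly_cancel[of "letter_a @ letter_w @ letter_a" W_letter False "word_K @ letter_a @ letter_w"]
      trace_poly_cancel[of "letter_a @ letter_w @ letter_a @ letter_a @ letter_w @ letter_a @ inv_word letter_w" A_letter False letter_w]
      trace_poly_cancel[of "awa @ letter_a @ letter_w @ letter_a" W_letter False "[]"]
    by (simp add: awa_def)
  also have "\<dots> = tr_awa ^ 2 - 2"
    using trace_poly_inv_word[of "awa" awa "[]"] trace_poly_word_eq[OF inv_word_cancel(1)[of "{}" awa]] w
    by (simp add: algebra_simps power2_eq_square)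
  finally show "trace_poly (word_B @ letter_w @ word_K @ letter_a @ letter_w) = tr_awa ^ 2 - 2" .
  show *: "trace_poly (rev word_K @ letter_a @ letter_w) = tr_awa * (1 - abelian_factor)"
    by (simp add: trace_poly_code tr_awa_def abelian_factor_def algebra_simps power2_eq_square)
  show "trace_poly (rev word_K @ letter_w @ letter_a @ letter_w) =
      var_z ^ 2 - 2 - (var_z ^ 2 - 1) * abelian_factor"
    by (simp add: trace_poly_code tr_awa_def abelian_factor_def algebra_simps power2_eq_square)
  \<comment> \<open>After cancelling w w^-1 the word contains the square of a w a, which
    Cayley-Hamilton lowers; the traces left are the one just computed and that of the
    commutator.\<close>
  let ?g = "inv_word letter_a @ inv_word letter_w"
  have "trace_poly (rev word_K @ letter_w @ rev word_B @ letter_a @ letter_w) =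
      trace_poly ((?g @ awa) @ awa @ letter_a @ letter_w)"
    using trace_poly_cancel[of "?g @ awa" W_letter True "letter_a @ letter_w @ letter_a @ letter_a @ letter_w"]
    by (simp add: awa_def)
  also have "\<dots> = tr_awa * trace_poly (?g @ awa @ letter_a @ letter_w) - trace_poly (?g @ letter_a @ letter_w)"
    using trace_poly_inv_word[of "?g @ awa" awa "letter_a @ letter_w"] w
      trace_poly_word_eq[OF word_eq_append[OF word_eq_refl[of _ ?g]
          word_eq_append[OF inv_word_cancel(1)[of _ awa] word_eq_refl[of _ "letter_a @ letter_w"]]]]
    by (simp add: algebra_simps)
  also have "trace_poly (?g @ awa @ letter_a @ letter_w) = tr_awa * (1 - abelian_factor)"
    using * by (simp add: awa_def)
  also have "trace_poly (?g @ letter_a @ letter_w) = 2 - abelian_factor"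
    by (simp add: trace_poly_code abelian_factor_def algebra_simps power2_eq_square)
  finally show "trace_poly (rev word_K @ letter_w @ rev word_B @ letter_a @ letter_w) =
      tr_awa ^ 2 - 2 - (tr_awa ^ 2 - 1) * abelian_factor"
    by (simp add: algebra_simps power2_eq_square)
qed

text \<open>Expanding the powers of u in both words, the parts free of \<open>abelian_factor\<close>
  cancel. The cofactor takes the stated form once \<open>tr_B\<close> is written as y
  \<open>tr_awa\<close> + 2 - z^2.\<close>

lemma defining_poly_eq: "defining_poly m n = abelian_factor * nonabelian_factor m n"
proof -
  define s where "s = cheb (m - 1) tr_B"
  define t where "t = cheb (m - 2) tr_B"
  define c where "c = cheb (n - 1) (tr_u m)"
  define d where "d = cheb (n - 2) (tr_u m)"
  have B: "tr_B = var_y * tr_awa + 2 - var_z ^ 2"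
    by (simp add: tr_B_def tr_awa_def algebra_simps power2_eq_square)
  have m: "cheb m tr_B - cheb (m - 1) tr_B = (var_y * tr_awa + 2 - var_z ^ 2) * s - t - s"
    using cheb_rec_down[of m tr_B] by (simp add: s_def t_def flip: B)
  have u: "tr_u m = var_y * s - tr_awa * t"
    by (simp add: tr_u_def s_def t_def)
  have n: "cheb (n - 1 - 1) (tr_u m) = d" "cheb (n - 1 - 2) (tr_u m) = tr_u m * d - c"
    using cheb_rec_down[of "n - 1" "tr_u m"] by (simp_all add: c_def d_def)
  let ?v = "letter_a @ letter_w"
  have "trace_poly (word_u m @ word_K @ ?v) = s * (var_z ^ 2 - 2) - t * (tr_awa ^ 2 - 2)"
    using trace_poly_word_u_context(1)[of "[]" m "word_K @ ?v"]
    unfolding append_Nil concrete_traces s_def t_def .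
  then have 1: "trace_poly (word_r m n @ ?v) =
      d * (s * (var_z ^ 2 - 2) - t * (tr_awa ^ 2 - 2)) - (tr_u m * d - c) * tr_awa"
    using trace_poly_word_pow[of "[]" "word_u m" "n - 1" "word_K @ ?v"]
    unfolding trace_poly_word_u n append_Nil concrete_traces by (simp add: word_r_def)
  have "trace_poly (rev word_K @ rev (word_u m) @ ?v) =
      s * (var_z ^ 2 - 2 - (var_z ^ 2 - 1) * abelian_factor)
      - t * (tr_awa ^ 2 - 2 - (tr_awa ^ 2 - 1) * abelian_factor)"
    unfolding trace_poly_word_u_context concrete_traces s_def t_def ..
  then have 2: "trace_poly (rev (word_r m n) @ ?v) =
      d * (s * (var_z ^ 2 - 2 - (var_z ^ 2 - 1) * abelian_factor)
      - t * (tr_awa ^ 2 - 2 - (tr_awa ^ 2 - 1) * abelian_factor))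
      - (tr_u m * d - c) * (tr_awa * (1 - abelian_factor))"
    using trace_poly_word_pow[of "rev word_K" "rev (word_u m)" "n - 1" ?v]
    unfolding trace_poly_word_u trace_poly_rev n concrete_traces by (simp add: word_r_def rev_word_pow)
  show ?thesis
    unfolding defining_poly_def 1 2 nonabelian_factor_def m c_def[symmetric] d_def[symmetric]
    unfolding u by (simp add: algebra_simps power2_eq_square)
qed

lemma defining_poly_dvd:
  assumes "word_eq (two_generator_relations m n) u v"
  shows "defining_poly m n dvd trace_poly u - trace_poly v"
proof -
  let ?r = "word_r m n"
  \<comment> \<open>In the expansion of g by 1, A, W, A W the first three terms cancel: reversal and
    cyclic invariance give r and its reversal equal traces, also with one letter appended.\<close>
  have rel: "defining_poly m n dvd trace_poly (?r @ g) - trace_poly (rev ?r @ g)" for g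
  proof -
    obtain p q r s where c: "coords g = (p, q, r, s)" by (metis prod_cases4)
    have "trace_poly (rev ?r @ [x]) = trace_poly (?r @ [x])" for x
      using trace_poly_rev[of "[x] @ ?r"] trace_poly_commute[of "[x]" ?r] by simp
    then have "trace_poly (?r @ g) - trace_poly (rev ?r @ g) = s * defining_poly m n"
      unfolding trace_poly_append_coords[OF c] defining_poly_def
      by (simp add: trace_poly_rev algebra_simps)
    then show ?thesis by simp
  qed
  \<comment> \<open>Contexts on both sides make the claim stable under the congruence. At a
    relation, cyclic invariance gathers them on the right.\<close>
  have "defining_poly m n dvd trace_poly (g @ u @ h) - trace_poly (g @ v @ h)" for g h
    using assms
  proof (induction arbitrary: g h)
    case (word_eq_sym u v)
    from dvd_minus_iff[THEN iffD2, OF word_eq_sym.IH[of g h]] show ?case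
      by (simp only: minus_diff_eq)
  next
    case (word_eq_trans u v w)
    from dvd_add[OF word_eq_trans.IH(1)[of g h] word_eq_trans.IH(2)[of g h]] show ?case by simp
  next
    case (word_eq_append u u' v v')
    have "defining_poly m n dvd
      (trace_poly (g @ u @ (v @ h)) - trace_poly (g @ u' @ (v @ h)))
       + (trace_poly ((g @ u') @ v @ h) - trace_poly ((g @ u') @ v' @ h))"
      by (intro dvd_add word_eq_append.IH)
    then show ?case by simp
  next
    case (word_eq_cancel x e)
    have "trace_poly (g @ [(x, e), (x, \<not> e)] @ h) = trace_poly (g @ [] @ h)"
      by (intro trace_poly_word_eq word_eq.word_eq_append word_eq.word_eq_cancel word_eq_refl)
    then show ?case by simp
  next
    case (word_eq_rel l r)
    then have lr: "l = ?r" "r = rev ?r" by (simp_all add: two_generator_relations_def)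
    show ?case
      using rel[of "h @ g"] trace_poly_commute[of g "l @ h"] trace_poly_commute[of g "r @ h"]
      by (simp add: lr)
  qed simp
  from this[of "[]" "[]"] show ?thesis by simp
qed

section \<open>The two presentations\<close>

context group
begin

lemma word_value_word_pow:
  assumes "range f \<subseteq> carrier G"
  shows "word_value G f (word_pow v k) = word_value G f v [^] k"
proof -
  have "word_value G f (concat (replicate j v)) = word_value G f v [^] j" for j :: nat and v
  proof (induction j)
    case (Suc j)
    have "word_value G f (concat (replicate (Suc j) v)) = word_value G f v \<otimes> word_value G f v [^] j"
      by (simp add: assms word_value_append Suc.IH)
    then show ?case by (simp only: nat_pow_Suc2 word_value_closed[OF assms])
  qed simp
  then show ?thesis
    using assms by (simp add: word_pow_def int_pow_def2 word_value_inv_word nat_pow_inv del: pow_nat)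
qed

lemma int_pow_conj:
  assumes "x \<in> carrier G" "g \<in> carrier G"
  shows "(inv g \<otimes> (x \<otimes> g)) [^] (k :: int) = inv g \<otimes> (x [^] k \<otimes> g)"
proof -
  have "(inv g \<otimes> (x \<otimes> g)) [^] j = inv g \<otimes> (x [^] j \<otimes> g)" for j :: nat
    using assms by (induction j) (simp_all add: m_assoc)
  then show ?thesis
    using assms by (simp add: int_pow_def2 inv_mult_group m_assoc del: pow_nat)
qed

lemma int_pow_pred:
  assumes "x \<in> carrier G"
  shows "x [^] (k - 1 :: int) = inv x \<otimes> x [^] k" "x [^] (k - 1 :: int) = x [^] k \<otimes> inv x"
  using int_pow_mult[OF assms, of "- 1" k] int_pow_mult[OF assms, of k "- 1"] assms
    int_pow_neg[OF assms, of 1]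
  by simp_all

text \<open>Elements of the two presentations are matched by \<open>w = (a c)\<^sup>m b a\<^sup>-\<^sup>1\<close> and, conversely,
  \<open>c = w a w\<^sup>-\<^sup>1\<close>, \<open>b = (a w a w\<^sup>-\<^sup>1)\<^sup>-\<^sup>m w a\<close>.\<close>

lemma meridians_from_w:
  assumes [simp]: "a \<in> carrier G" "b \<in> carrier G" "c \<in> carrier G"
    and rel: "b \<otimes> (a \<otimes> inv b) = (a \<otimes> c) [^] (- m) \<otimes> (c \<otimes> (a \<otimes> c) [^] (m :: int))"
    and w: "w = (a \<otimes> c) [^] m \<otimes> (b \<otimes> inv a)"
  shows "c = w \<otimes> (a \<otimes> inv w)"
    and "b = (a \<otimes> (w \<otimes> (a \<otimes> inv w))) [^] (- m) \<otimes> (w \<otimes> a)"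
proof -
  define M where "M = (a \<otimes> c) [^] m"
  have [simp]: "M \<in> carrier G" by (simp add: M_def)
  have Mi: "(a \<otimes> c) [^] (- m) = inv M" by (simp add: M_def int_pow_neg)
  have "w \<otimes> (a \<otimes> inv w) = M \<otimes> ((b \<otimes> (a \<otimes> inv b)) \<otimes> inv M)"
    by (simp add: w M_def[symmetric] inv_mult_group m_assoc)
  also have "\<dots> = c"
    unfolding rel Mi M_def[symmetric] by (simp add: m_assoc)
  finally show c: "c = w \<otimes> (a \<otimes> inv w)" by simp
  show "b = (a \<otimes> (w \<otimes> (a \<otimes> inv w))) [^] (- m) \<otimes> (w \<otimes> a)"
    unfolding c[symmetric] Mi by (simp add: w M_def[symmetric] m_assoc)
qed

text \<open>The formulas for b and c solve the first pretzel relation identically. In the second, c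
  b is the conjugate of u by a, so powers of c b become powers of u.\<close>

lemma two_generator_relation_iff:
  fixes m n :: int
  assumes [simp]: "a \<in> carrier G" "w \<in> carrier G"
  defines "B \<equiv> a \<otimes> (w \<otimes> (a \<otimes> inv w))"
  defines "b \<equiv> B [^] (- m) \<otimes> (w \<otimes> a)" and "c \<equiv> w \<otimes> (a \<otimes> inv w)"
  shows "b \<otimes> (a \<otimes> inv b) = (a \<otimes> c) [^] (- m) \<otimes> (c \<otimes> (a \<otimes> c) [^] m)"
    and "inv a \<otimes> (b \<otimes> a) = (c \<otimes> b) [^] n \<otimes> (b \<otimes> (c \<otimes> b) [^] (- n)) \<longleftrightarrow>
      word_value G (case_letter a w) (word_r m n) = word_value G (case_letter a w) (rev (word_r m n))"
proof -
  have [simp]: "B \<in> carrier G" "b \<in> carrier G" "c \<in> carrier G"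
    by (simp_all add: B_def b_def c_def)
  have ac: "a \<otimes> c = B" by (simp add: B_def c_def)
  show "b \<otimes> (a \<otimes> inv b) = (a \<otimes> c) [^] (- m) \<otimes> (c \<otimes> (a \<otimes> c) [^] m)"
    unfolding ac by (simp add: b_def c_def inv_mult_group m_assoc int_pow_neg)
  have range: "range (case_letter a w) \<subseteq> carrier G" by (simp add: range_case_letter)
  define u where "u = B [^] (1 - m) \<otimes> w"
  have [simp]: "u \<in> carrier G" by (simp add: u_def)
  \<comment> \<open>The value of the reversal of \<open>word_B\<close>. From B w = w
    \<open>B'\<close> it follows that u is also the value of the reversal of
    \<open>word_u m\<close>.\<close>
  define B' where "B' = inv w \<otimes> (a \<otimes> (w \<otimes> a))"
  have [simp]: "B' \<in> carrier G" by (simp add: B'_def)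
  have B': "B' = inv w \<otimes> (B \<otimes> w)"
    by (simp add: B_def B'_def m_assoc)
  have u': "u = w \<otimes> B' [^] (1 - m)"
    by (simp add: B' int_pow_conj u_def)
  have Bm: "B [^] (- m) = inv B \<otimes> B [^] (1 - m)"
    using int_pow_pred(1)[of B "1 - m"] by simp
  have b: "b = inv B \<otimes> (u \<otimes> a)"
    by (simp add: b_def u_def Bm m_assoc)
  have cb: "c \<otimes> b = inv a \<otimes> (u \<otimes> a)"
    unfolding b by (simp add: B_def c_def inv_mult_group m_assoc)
  define V where "V = u [^] (n - 1)"
  have [simp]: "V \<in> carrier G" by (simp add: V_def)
  have un: "u [^] n = u \<otimes> V" "u [^] n = V \<otimes> u"
    unfolding V_def by (simp add: int_pow_pred(1)) (simp add: int_pow_pred(2) m_assoc)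
  define K where "K = a \<otimes> (w \<otimes> (a \<otimes> (inv w \<otimes> inv a)))"
  define K' where "K' = inv a \<otimes> (inv w \<otimes> (a \<otimes> (w \<otimes> a)))"
  have [simp]: "K \<in> carrier G" "K' \<in> carrier G" by (simp_all add: K_def K'_def)
  have uB: "inv u \<otimes> (inv B \<otimes> u) = inv B'"
  proof -
    have comm: "B' [^] (1 - m) \<otimes> B' = B' \<otimes> B' [^] (1 - m)"
      using int_pow_mult[of B' "1 - m" 1] int_pow_mult[of B' 1 "1 - m"] by (simp add: add.commute)
    have "u \<otimes> B' = B \<otimes> u"
      unfolding u' by (simp add: m_assoc comm) (simp add: B' m_assoc)
    then have "B' = inv u \<otimes> (B \<otimes> u)" by (metis inv_cancel_left(1) \<open>u \<in> carrier G\<close> \<open>B' \<in> carrier G\<close>)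
    then show ?thesis by (simp add: inv_mult_group m_assoc)
  qed
  have cancel: "s = t \<longleftrightarrow> g \<otimes> (s \<otimes> h) = g \<otimes> (t \<otimes> h)"
    if "s \<in> carrier G" "t \<in> carrier G" "g \<in> carrier G" "h \<in> carrier G" for g h s t
    using that by simp
  \<comment> \<open>With these multipliers the sides become K'^-1 V and V K^-1, so the relation
    reads V K = K' V, which is r equal to its reversal.\<close>
  have "inv a \<otimes> (b \<otimes> a) = (c \<otimes> b) [^] n \<otimes> (b \<otimes> (c \<otimes> b) [^] (- n)) \<longleftrightarrow>
      (inv u \<otimes> a) \<otimes> ((inv a \<otimes> (b \<otimes> a)) \<otimes> (inv a \<otimes> V)) =
      (inv u \<otimes> a) \<otimes> (((c \<otimes> b) [^] n \<otimes> (b \<otimes> (c \<otimes> b) [^] (- n))) \<otimes> (inv a \<otimes> V))"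
    by (rule cancel) simp_all
  also have "(inv u \<otimes> a) \<otimes> ((inv a \<otimes> (b \<otimes> a)) \<otimes> (inv a \<otimes> V)) = inv K' \<otimes> V"
  proof -
    have "(inv u \<otimes> a) \<otimes> ((inv a \<otimes> (b \<otimes> a)) \<otimes> (inv a \<otimes> V)) = (inv u \<otimes> (inv B \<otimes> u)) \<otimes> (a \<otimes> V)"
      unfolding b by (simp add: m_assoc)
    also have "\<dots> = inv K' \<otimes> V"
      unfolding uB by (simp add: B'_def K'_def inv_mult_group m_assoc)
    finally show ?thesis .
  qed
  also have "(inv u \<otimes> a) \<otimes> (((c \<otimes> b) [^] n \<otimes> (b \<otimes> (c \<otimes> b) [^] (- n))) \<otimes> (inv a \<otimes> V)) = V \<otimes> inv K"
  proof -
    have n: "(c \<otimes> b) [^] n = inv a \<otimes> (u \<otimes> (V \<otimes> a))"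
      by (simp add: cb int_pow_conj un(1) m_assoc)
    have n': "(c \<otimes> b) [^] (- n) = inv a \<otimes> (inv u \<otimes> (inv V \<otimes> a))"
    proof -
      have "(c \<otimes> b) [^] n = inv a \<otimes> (V \<otimes> (u \<otimes> a))"
        by (simp add: cb int_pow_conj un(2) m_assoc)
      then show ?thesis by (simp add: int_pow_neg inv_mult_group m_assoc)
    qed
    show ?thesis
      unfolding n n' unfolding b by (simp add: m_assoc) (simp add: B_def K_def inv_mult_group m_assoc)
  qed
  also have "inv K' \<otimes> V = V \<otimes> inv K \<longleftrightarrow> K' \<otimes> ((inv K' \<otimes> V) \<otimes> K) = K' \<otimes> ((V \<otimes> inv K) \<otimes> K)"
    by (rule cancel) simp_all
  also have "\<dots> \<longleftrightarrow> V \<otimes> K = K' \<otimes> V"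
    by (simp add: m_assoc)
  also have "V \<otimes> K = word_value G (case_letter a w) (word_r m n)"
    by (simp add: word_r_def word_u_def word_value_append range word_value_word_pow V_def u_def K_def B_def)
  also have "K' \<otimes> V = word_value G (case_letter a w) (rev (word_r m n))"
  proof -
    have "rev (word_r m n) = rev word_K @ word_pow (letter_w @ word_pow (rev word_B) (1 - m)) (n - 1)"
      by (simp add: word_r_def word_u_def rev_word_pow)
    then show ?thesis
      by (simp add: word_value_append range word_value_word_pow V_def u' K'_def B'_def m_assoc)
  qed
  finally show "inv a \<otimes> (b \<otimes> a) = (c \<otimes> b) [^] n \<otimes> (b \<otimes> (c \<otimes> b) [^] (- n)) \<longleftrightarrow>
      word_value G (case_letter a w) (word_r m n) = word_value G (case_letter a w) (rev (word_r m n))" .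
qed

lemma generating_pair_word:
  assumes "generating_pair G g h" "x \<in> carrier G"
  shows "\<exists>u. word_value G (case_letter g h) u = x"
proof -
  have c: "g \<in> carrier G" "h \<in> carrier G" and x: "x \<in> generate G {g, h}"
    using assms by (auto simp: generating_pair_def)
  then have range: "range (case_letter g h) \<subseteq> carrier G" by (simp add: range_case_letter)
  from x show ?thesis
  proof induction
    case one
    show ?case by (rule exI[of _ "[]"]) simp
  next
    case (incl y)
    then show ?case
      using c by (auto intro: exI[of _ letter_a] exI[of _ letter_w])
  next
    case (inv y)
    then show ?case
      using c by (auto intro: exI[of _ "[(A_letter, False)]"] exI[of _ "[(W_letter, False)]"])
  next
    case (eng y z)
    then show ?case using word_value_append[OF range] by metis
  qed
qed

lemma generating_pairI:
  assumes "a \<in> carrier G" "w \<in> carrier G"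
    and "\<And>x. x \<in> carrier G \<Longrightarrow> \<exists>u. x = word_value G (case_letter a w) u"
  shows "generating_pair G a w"
proof -
  have "word_value G (case_letter a w) u \<in> generate G {a, w}" for u
  proof (induction u)
    case (Cons x u)
    obtain l e where x: "x = (l, e)" by force
    have "case_letter a w l \<in> {a, w}" by (cases l) simp_all
    with Cons show ?case
      by (auto simp: x intro: generate.intros)
  qed (simp add: generate.one)
  with assms have "carrier G \<subseteq> generate G {a, w}" by blast
  moreover have "generate G {a, w} \<subseteq> carrier G" using assms by (intro generate_incl) auto
  ultimately show ?thesis using assms by (auto simp: generating_pair_def)
qed

end

text \<open>Classes are sets of words, so the carrier determines the congruence. This matches the
  meridian a of the Wirtinger presentation with the generator a of the presentation by a, b,
  c.\<close>

lemma word_class_eq_of_presented_group_eq: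
  assumes "presented_group R = presented_group R'"
  shows "word_class R u = word_class R' u"
proof -
  have "word_class R u \<in> carrier (presented_group R')"
    unfolding assms[symmetric] by simp
  then obtain v where v: "word_class R u = word_class R' v" by (auto simp: presented_group_def)
  moreover have "u \<in> word_class R u" by (simp add: word_class_def word_eq_refl)
  ultimately have "word_eq R' v u" by (simp add: word_class_def)
  with v show ?thesis by (simp add: word_class_eq_iff)
qed

lemma hom_presented_group_eqI:
  assumes "\<phi> \<in> hom (presented_group R) G" "\<psi> \<in> hom (presented_group R) G" "group G"
    and "\<And>g. \<phi> (word_class R [(g, True)]) = \<psi> (word_class R [(g, True)])"
    and "S \<in> carrier (presented_group R)"
  shows "\<phi> S = \<psi> S"
proof -
  obtain u where "S = word_class R u" using assms(5) by (auto simp: presented_group_def)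
  then show ?thesis
    using hom_presented_group_word_class[OF assms(1,3), of u] hom_presented_group_word_class[OF assms(2,3), of u]
    by (simp only: assms(4))
qed

text \<open>Maps in both directions come from the universal property of the presentations, and their
  composites are the identity because they fix the generators.\<close>

lemma pretzel_link_group_iso:
  fixes m n :: int
  defines "L \<equiv> pretzel_link_group (-2) (2 * m + 1) (2 * n)"
  defines "R \<equiv> two_generator_relations m n"
  obtains \<phi> w where "\<phi> \<in> iso L (two_generator_group m n)"
    "\<phi> (pretzel_meridian_a (-2) (2 * m + 1) (2 * n)) = word_class R letter_a"
    "w \<in> carrier L" "\<phi> w = word_class R letter_w"
proof -
  let ?T = "two_generator_group m n"
  let ?Q = "pretzel_relations_abc m n"
  have L: "L = presented_group ?Q" by (simp add: L_def pretzel_link_group_eq)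
  have T: "?T = presented_group R" by (simp add: two_generator_group_def R_def)
  interpret L: group L unfolding L by (rule presented_group_is_group)
  interpret T: group ?T unfolding T by (rule presented_group_is_group)
  have clT: "word_class R v \<in> carrier ?T" for v by (simp add: T)
  have clL: "word_class ?Q v \<in> carrier L" for v by (simp add: L)
  define a where "a = word_class R letter_a"
  define w where "w = word_class R letter_w"
  define B where "B = a \<otimes>\<^bsub>?T\<^esub> (w \<otimes>\<^bsub>?T\<^esub> (a \<otimes>\<^bsub>?T\<^esub> inv\<^bsub>?T\<^esub> w))"
  define b where "b = B [^]\<^bsub>?T\<^esub> (- m) \<otimes>\<^bsub>?T\<^esub> (w \<otimes>\<^bsub>?T\<^esub> a)"
  define c where "c = w \<otimes>\<^bsub>?T\<^esub> (a \<otimes>\<^bsub>?T\<^esub> inv\<^bsub>?T\<^esub> w)"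
  have [simp]: "a \<in> carrier ?T" "w \<in> carrier ?T" by (simp_all add: a_def w_def clT)
  then have [simp]: "B \<in> carrier ?T" "b \<in> carrier ?T" "c \<in> carrier ?T"
    by (simp_all add: B_def b_def c_def)
  have gen: "(\<lambda>g. word_class R [(g, True)]) = case_letter a w"
    by (auto simp: a_def w_def split: letter.splits)
  have valT: "word_value ?T (case_letter a w) u = word_class R u" for u
    using word_value_presented_group[of R u] by (simp add: gen T)
  have "word_class R (word_r m n) = word_class R (rev (word_r m n))"
    by (simp add: word_class_eq_iff) (rule word_eq_rel, simp add: R_def two_generator_relations_def)
  then have relT: "b \<otimes>\<^bsub>?T\<^esub> (a \<otimes>\<^bsub>?T\<^esub> inv\<^bsub>?T\<^esub> b) = (a \<otimes>\<^bsub>?T\<^esub> c) [^]\<^bsub>?T\<^esub> (- m) \<otimes>\<^bsub>?T\<^esub> (c \<otimes>\<^bsub>?T\<^esub> (a \<otimes>\<^bsub>?T\<^esub> c) [^]\<^bsub>?T\<^esub> m)"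
    "inv\<^bsub>?T\<^esub> a \<otimes>\<^bsub>?T\<^esub> (b \<otimes>\<^bsub>?T\<^esub> a) = (c \<otimes>\<^bsub>?T\<^esub> b) [^]\<^bsub>?T\<^esub> n \<otimes>\<^bsub>?T\<^esub> (b \<otimes>\<^bsub>?T\<^esub> (c \<otimes>\<^bsub>?T\<^esub> b) [^]\<^bsub>?T\<^esub> (- n))"
    using T.two_generator_relation_iff(1)[of a w, where m = m] T.two_generator_relation_iff(2)[of a w, where m = m and n = n] by (simp_all add: b_def c_def B_def valT)
  let ?f = "case_meridian a b c"
  have f: "range ?f \<subseteq> carrier ?T" by (auto split: meridian.splits)
  have frel: "word_value ?T ?f l = word_value ?T ?f r" if "(l, r) \<in> ?Q" for l r
    using that relT
    by (auto simp: pretzel_relations_abc_def Let_def T.word_value_append f T.word_value_word_pow T.m_assoc)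
  define \<phi> where "\<phi> = group.presented_hom ?T ?f"
  have \<phi>: "\<phi> \<in> hom L ?T" "\<phi> (word_class ?Q u) = word_value ?T ?f u" for u
    unfolding \<phi>_def L using T.presented_hom[OF f, of ?Q] frel by auto
  define a' where "a' = word_class ?Q [(Mer_a, True)]"
  define b' where "b' = word_class ?Q [(Mer_b, True)]"
  define c' where "c' = word_class ?Q [(Mer_c, True)]"
  have [simp]: "a' \<in> carrier L" "b' \<in> carrier L" "c' \<in> carrier L"
    by (simp_all add: a'_def b'_def c'_def clL)
  define w' where "w' = (a' \<otimes>\<^bsub>L\<^esub> c') [^]\<^bsub>L\<^esub> m \<otimes>\<^bsub>L\<^esub> (b' \<otimes>\<^bsub>L\<^esub> inv\<^bsub>L\<^esub> a')"
  have [simp]: "w' \<in> carrier L" by (simp add: w'_def)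
  have relL: "b' \<otimes>\<^bsub>L\<^esub> (a' \<otimes>\<^bsub>L\<^esub> inv\<^bsub>L\<^esub> b') = (a' \<otimes>\<^bsub>L\<^esub> c') [^]\<^bsub>L\<^esub> (- m) \<otimes>\<^bsub>L\<^esub> (c' \<otimes>\<^bsub>L\<^esub> (a' \<otimes>\<^bsub>L\<^esub> c') [^]\<^bsub>L\<^esub> m)"
    "inv\<^bsub>L\<^esub> a' \<otimes>\<^bsub>L\<^esub> (b' \<otimes>\<^bsub>L\<^esub> a') = (c' \<otimes>\<^bsub>L\<^esub> b') [^]\<^bsub>L\<^esub> n \<otimes>\<^bsub>L\<^esub> (b' \<otimes>\<^bsub>L\<^esub> (c' \<otimes>\<^bsub>L\<^esub> b') [^]\<^bsub>L\<^esub> (- n))"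
  proof -
    have "word_class ?Q l = word_class ?Q r" if "(l, r) \<in> ?Q" for l r
      using that by (simp add: word_class_eq_iff word_eq_rel)
    then show "b' \<otimes>\<^bsub>L\<^esub> (a' \<otimes>\<^bsub>L\<^esub> inv\<^bsub>L\<^esub> b') = (a' \<otimes>\<^bsub>L\<^esub> c') [^]\<^bsub>L\<^esub> (- m) \<otimes>\<^bsub>L\<^esub> (c' \<otimes>\<^bsub>L\<^esub> (a' \<otimes>\<^bsub>L\<^esub> c') [^]\<^bsub>L\<^esub> m)"
      "inv\<^bsub>L\<^esub> a' \<otimes>\<^bsub>L\<^esub> (b' \<otimes>\<^bsub>L\<^esub> a') = (c' \<otimes>\<^bsub>L\<^esub> b') [^]\<^bsub>L\<^esub> n \<otimes>\<^bsub>L\<^esub> (b' \<otimes>\<^bsub>L\<^esub> (c' \<otimes>\<^bsub>L\<^esub> b') [^]\<^bsub>L\<^esub> (- n))"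
      unfolding a'_def b'_def c'_def L word_class_append word_class_inv[symmetric] word_class_pow[symmetric]
      by (simp_all add: pretzel_relations_abc_def Let_def)
  qed
  \<comment> \<open>With b' and c' expressed by a' and w', \<open>two_generator_relation_iff\<close>
    translates the second relation of the link group into r = reversed r.\<close>
  note bc' = L.meridians_from_w[OF _ _ _ relL(1) w'_def]
  let ?h = "case_letter a' w'"
  have h: "range ?h \<subseteq> carrier L" by (simp add: range_case_letter)
  have "word_value L ?h (word_r m n) = word_value L ?h (rev (word_r m n))"
    using L.two_generator_relation_iff(2)[of a' w', where m = m and n = n] bc' relL(2) by simp
  then have hrel: "word_value L ?h l = word_value L ?h r" if "(l, r) \<in> R" for l r
    using that by (auto simp: R_def two_generator_relations_def)
  define \<psi> where "\<psi> = group.presented_hom L ?h"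
  have \<psi>: "\<psi> \<in> hom ?T L" "\<psi> (word_class R u) = word_value L ?h u" for u
    unfolding \<psi>_def T using L.presented_hom[OF h, of R] hrel by auto
  interpret \<phi>: group_hom L ?T \<phi> by unfold_locales (rule \<phi>(1))
  interpret \<psi>: group_hom ?T L \<psi> by unfold_locales (rule \<psi>(1))
  have \<phi>a: "\<phi> a' = a" "\<phi> b' = b" "\<phi> c' = c" by (simp_all add: a'_def b'_def c'_def \<phi>(2))
  have \<psi>a: "\<psi> a = a'" "\<psi> w = w'" by (simp_all add: a_def w_def \<psi>(2))
  have \<phi>w: "\<phi> w' = w"
    by (simp add: w'_def \<phi>a \<phi>.hom_int_pow)
       (simp add: b_def B_def c_def T.int_pow_neg T.m_assoc)
  have \<psi>b: "\<psi> b = b'" "\<psi> c = c'"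
    using bc' by (simp_all add: b_def B_def c_def \<psi>a \<psi>.hom_int_pow)
  have 1: "\<psi> (\<phi> s) = s" if "s \<in> carrier L" for s
  proof -
    have "(\<psi> \<circ> \<phi>) s = id s"
    proof (rule hom_presented_group_eqI[of "\<psi> \<circ> \<phi>" ?Q L id])
      show "\<psi> \<circ> \<phi> \<in> hom (presented_group ?Q) L" "id \<in> hom (presented_group ?Q) L"
        using hom_compose[OF \<phi>(1) \<psi>(1)] by (auto simp: L[symmetric] hom_def)
      show "(\<psi> \<circ> \<phi>) (word_class ?Q [(g, True)]) = id (word_class ?Q [(g, True)])" for g
        by (cases g) (simp_all add: a'_def[symmetric] b'_def[symmetric] c'_def[symmetric] \<phi>a \<psi>a \<psi>b)
    qed (use that in \<open>simp_all add: L presented_group_is_group\<close>)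
    then show ?thesis by simp
  qed
  have 2: "\<phi> (\<psi> t) = t" if "t \<in> carrier ?T" for t
  proof -
    have "(\<phi> \<circ> \<psi>) t = id t"
    proof (rule hom_presented_group_eqI[of "\<phi> \<circ> \<psi>" R ?T id])
      show "\<phi> \<circ> \<psi> \<in> hom (presented_group R) ?T" "id \<in> hom (presented_group R) ?T"
        using hom_compose[OF \<psi>(1) \<phi>(1)] by (auto simp: T[symmetric] hom_def)
      show "(\<phi> \<circ> \<psi>) (word_class R [(g, True)]) = id (word_class R [(g, True)])" for g
        by (cases g) (simp_all add: a_def[symmetric] w_def[symmetric] \<phi>a \<psi>a \<phi>w)
    qed (use that in \<open>simp_all add: T presented_group_is_group\<close>)
    then show ?thesis by simp
  qed
  have "bij_betw \<phi> (carrier L) (carrier ?T)"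
    by (rule bij_betw_byWitness[of _ \<psi>]) (use 1 2 in \<open>auto\<close>)
  then have iso: "\<phi> \<in> iso L ?T" using \<phi>(1) by (simp add: iso_def)
  have "pretzel_meridian_a (-2) (2 * m + 1) (2 * n) = a'"
    unfolding pretzel_meridian_a_def a'_def
    by (rule word_class_eq_of_presented_group_eq)
      (simp add: pretzel_link_group_eq pretzel_link_group_def[symmetric])
  with that[OF iso _ _ \<phi>w[unfolded w_def]] show thesis by (simp add: \<phi>a a_def)
qed

section \<open>The universal character ring\<close>

lemma ring_xyz_simps [simp]:
  "carrier ring_xyz = UNIV" "p \<otimes>\<^bsub>ring_xyz\<^esub> q = p * q" "p \<oplus>\<^bsub>ring_xyz\<^esub> q = p + q"
  "\<zero>\<^bsub>ring_xyz\<^esub> = 0" "\<one>\<^bsub>ring_xyz\<^esub> = 1"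
  by (simp_all add: ring_of_type_algebra_def)

lemma ring_xyz: "ring ring_xyz" "cring ring_xyz"
  by (rule ring_from_type_algebra cring_from_type_algebra)+

lemma nat_pow_ring_xyz: "p [^]\<^bsub>ring_xyz\<^esub> (k :: nat) = p ^ k"
proof -
  interpret ring ring_xyz by (rule ring_xyz)
  show ?thesis by (induction k) (simp_all add: mult.commute)
qed

lemma ideal_ring_xyzI:
  assumes "0 \<in> I" "\<And>p q. p \<in> I \<Longrightarrow> q \<in> I \<Longrightarrow> p + q \<in> I" "\<And>p q. p \<in> I \<Longrightarrow> q * p \<in> I"
  shows "ideal I ring_xyz"
proof (rule idealI)
  interpret ring ring_xyz by (rule ring_xyz)
  have minus: "- p \<in> I" if "p \<in> I" for p using assms(3)[OF that, of "- 1"] by simp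
  have "inv\<^bsub>add_monoid ring_xyz\<^esub> p = - p" for p
    using minus_equality[of "- p" p] by (simp add: a_inv_def)
  then show "subgroup I (add_monoid ring_xyz)"
    by unfold_locales (use assms minus in \<open>auto simp: a_inv_def\<close>)
qed (use assms ring_xyz in \<open>auto simp: mult.commute\<close>)

lemma ideal_ring_xyzD:
  assumes "ideal I ring_xyz"
  shows "0 \<in> I" "p \<in> I \<Longrightarrow> q \<in> I \<Longrightarrow> p + q \<in> I" "p \<in> I \<Longrightarrow> q * p \<in> I"
    "p \<in> I \<Longrightarrow> q \<in> I \<Longrightarrow> p - q \<in> I"
proof -
  interpret ideal I ring_xyz by (rule assms)
  have sub: "additive_subgroup I ring_xyz" by (rule ideal.axioms(1)[OF assms])
  show "0 \<in> I" using additive_subgroup.zero_closed[OF sub] by simp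
  show add: "p \<in> I \<Longrightarrow> q \<in> I \<Longrightarrow> p + q \<in> I" for p q
    using additive_subgroup.a_closed[OF sub, of p q] by simp
  show mult: "p \<in> I \<Longrightarrow> q * p \<in> I" for p q using I_l_closed[of p q] by simp
  show "p \<in> I \<Longrightarrow> q \<in> I \<Longrightarrow> p - q \<in> I" using add[of p "- 1 * q"] mult[of q "- 1"] by simp
qed

definition trace_relations :: "('a, 'b) monoid_scheme \<Rightarrow> 'a \<Rightarrow> 'a \<Rightarrow> poly_xyz set" where
  "trace_relations G g h = {trace_poly u - trace_poly v | u v.
     word_value G (case_letter g h) u = word_value G (case_letter g h) v}"

lemma
  shows ideal_trace_ideal: "ideal (trace_ideal G g h) ring_xyz"
    and trace_relations_subset: "trace_relations G g h \<subseteq> trace_ideal G g h"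
    and trace_ideal_minimal: "ideal I ring_xyz \<Longrightarrow> trace_relations G g h \<subseteq> I \<Longrightarrow> trace_ideal G g h \<subseteq> I"
proof -
  interpret ring ring_xyz by (rule ring_xyz)
  have eq: "trace_ideal G g h = genideal ring_xyz (trace_relations G g h)"
    by (simp add: trace_ideal_def trace_relations_def)
  show "ideal (trace_ideal G g h) ring_xyz" unfolding eq by (rule genideal_ideal) simp
  show "trace_relations G g h \<subseteq> trace_ideal G g h" unfolding eq by (rule genideal_self) simp
  show "ideal I ring_xyz \<Longrightarrow> trace_relations G g h \<subseteq> I \<Longrightarrow> trace_ideal G g h \<subseteq> I"
    unfolding eq by (rule genideal_minimal)
qed

lemma cgenideal_ring_xyz: "PIdl\<^bsub>ring_xyz\<^esub> f = {p. f dvd p}"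
  by (auto simp: cgenideal_def dvd_def mult.commute)

lemma trace_ideal_eq_cgenideal:
  assumes "f \<in> trace_relations G g h" "\<And>p. p \<in> trace_relations G g h \<Longrightarrow> f dvd p"
  shows "trace_ideal G g h = PIdl\<^bsub>ring_xyz\<^esub> f"
proof
  have "ideal {p. f dvd p} ring_xyz" by (rule ideal_ring_xyzI) auto
  then show "trace_ideal G g h \<subseteq> PIdl\<^bsub>ring_xyz\<^esub> f"
    unfolding cgenideal_ring_xyz using assms(2) by (intro trace_ideal_minimal) auto
  have "f \<in> trace_ideal G g h" by (rule subsetD[OF trace_relations_subset assms(1)])
  then show "PIdl\<^bsub>ring_xyz\<^esub> f \<subseteq> trace_ideal G g h"
    unfolding cgenideal_ring_xyz
    by (auto elim!: dvdE simp: mult.commute[of f] intro: ideal_ring_xyzD(3)[OF ideal_trace_ideal])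
qed

lemma reduced_ring_Quot:
  assumes "ideal I ring_xyz" "\<And>p k. p ^ k \<in> I \<Longrightarrow> p \<in> I"
  shows "reduced_ring (ring_xyz Quot I)"
proof -
  interpret ideal I ring_xyz by (rule assms)
  interpret Q: ring "ring_xyz Quot I" by (rule quotient_is_ring)
  interpret hom: ring_hom_ring ring_xyz "ring_xyz Quot I" "\<lambda>p. I +>\<^bsub>ring_xyz\<^esub> p"
    by (rule rcos_ring_hom_ring)
  have carrier: "carrier (ring_xyz Quot I) = range (\<lambda>p. I +>\<^bsub>ring_xyz\<^esub> p)"
    unfolding FactRing_def A_RCOSETS_def' by auto
  have zero: "\<zero>\<^bsub>ring_xyz Quot I\<^esub> = I" by (simp add: FactRing_def)
  have "s = I" if s: "s \<in> carrier (ring_xyz Quot I)" "s [^]\<^bsub>ring_xyz Quot I\<^esub> k = I" for s and k :: nat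
  proof -
    obtain p where p: "s = I +>\<^bsub>ring_xyz\<^esub> p"
      using s(1) unfolding carrier by (rule imageE)
    have "I +>\<^bsub>ring_xyz\<^esub> (p ^ k) = I"
      using s(2) hom.hom_nat_pow[of p k] by (simp add: p nat_pow_ring_xyz)
    then have "p ^ k \<in> I" using a_rcos_self[of "p ^ k"] by simp
    then have "p \<in> I" by (rule assms(2))
    then show ?thesis unfolding p by (simp add: a_rcos_const)
  qed
  moreover have "I \<in> carrier (ring_xyz Quot I)" using Q.zero_closed by (simp add: zero)
  moreover have "I [^]\<^bsub>ring_xyz Quot I\<^esub> (1 :: nat) = I"
    using Q.nat_pow_eone[of I] \<open>I \<in> carrier (ring_xyz Quot I)\<close> by simp
  ultimately show ?thesis unfolding reduced_ring_def nilradical_def zero by blast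
qed

section \<open>Independence of the generating pair\<close>

definition subst_xyz :: "poly_xyz \<Rightarrow> poly_xyz \<Rightarrow> poly_xyz \<Rightarrow> poly_xyz \<Rightarrow> poly_xyz" where
  "subst_xyz p q r s = (SOME t. \<forall>x y z.
     eval_xyz t x y z = eval_xyz s (eval_xyz p x y z) (eval_xyz q x y z) (eval_xyz r x y z))"

text \<open>A suitable polynomial exists by induction on s. Since evaluations determine a
  polynomial, the choice in \<open>subst_xyz\<close> is the ring endomorphism sending x, y, z to p,
  q, r.\<close>

lemma eval_subst_xyz [simp]:
  "eval_xyz (subst_xyz p q r s) x y z = eval_xyz s (eval_xyz p x y z) (eval_xyz q x y z) (eval_xyz r x y z)"
proof -
  have "\<exists>t. \<forall>x y z. eval_xyz t x y z = eval_xyz s (eval_xyz p x y z) (eval_xyz q x y z) (eval_xyz r x y z)"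
  proof (induction s rule: poly_xyz_induct)
    case (const c)
    show ?case by (rule exI[of _ "const_xyz c"]) simp
  next
    case x
    show ?case by (rule exI[of _ p]) simp
  next
    case y
    show ?case by (rule exI[of _ q]) simp
  next
    case z
    show ?case by (rule exI[of _ r]) simp
  next
    case (add s s')
    then obtain t t' where
      "\<forall>x y z. eval_xyz t x y z = eval_xyz s (eval_xyz p x y z) (eval_xyz q x y z) (eval_xyz r x y z)"
      "\<forall>x y z. eval_xyz t' x y z = eval_xyz s' (eval_xyz p x y z) (eval_xyz q x y z) (eval_xyz r x y z)"
      by blast
    then show ?case by (intro exI[of _ "t + t'"]) simp
  next
    case (mult s s')
    then obtain t t' where
      "\<forall>x y z. eval_xyz t x y z = eval_xyz s (eval_xyz p x y z) (eval_xyz q x y z) (eval_xyz r x y z)"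
      "\<forall>x y z. eval_xyz t' x y z = eval_xyz s' (eval_xyz p x y z) (eval_xyz q x y z) (eval_xyz r x y z)"
      by blast
    then show ?case by (intro exI[of _ "t * t'"]) simp
  qed
  then have "\<forall>x y z. eval_xyz (subst_xyz p q r s) x y z =
      eval_xyz s (eval_xyz p x y z) (eval_xyz q x y z) (eval_xyz r x y z)"
    unfolding subst_xyz_def by (rule someI_ex)
  then show ?thesis by blast
qed

lemma subst_xyz_simps:
  "subst_xyz p q r (s + t) = subst_xyz p q r s + subst_xyz p q r t"
  "subst_xyz p q r (s - t) = subst_xyz p q r s - subst_xyz p q r t"
  "subst_xyz p q r (s * t) = subst_xyz p q r s * subst_xyz p q r t"
  "subst_xyz p q r (s ^ k) = subst_xyz p q r s ^ k"
  "subst_xyz p q r 0 = 0"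
  "subst_xyz p q r (const_xyz c) = const_xyz c"
  "subst_xyz p q r var_x = p" "subst_xyz p q r var_y = q" "subst_xyz p q r var_z = r"
  by (intro eval_xyz_eqI; simp)+

definition word_subst :: "letter word \<Rightarrow> letter word \<Rightarrow> letter word \<Rightarrow> letter word" where
  "word_subst u v t = concat (map (\<lambda>(g, e). if e then case_letter u v g else inv_word (case_letter u v g)) t)"

lemma (in group) word_value_word_subst:
  assumes "range f \<subseteq> carrier G"
  shows "word_value G f (word_subst u v t) = word_value G (case_letter (word_value G f u) (word_value G f v)) t"
proof (induction t)
  case (Cons x t)
  obtain g e where x: "x = (g, e)" by force
  have "word_value G f (case_letter u v g) = case_letter (word_value G f u) (word_value G f v) g"
    by (cases g) simp_all
  with Cons show ?case
    by (simp add: x word_subst_def word_value_append word_value_inv_word assms)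
qed (simp add: word_subst_def)

definition trace_subst :: "letter word \<Rightarrow> letter word \<Rightarrow> poly_xyz \<Rightarrow> poly_xyz" where
  "trace_subst u v = subst_xyz (trace_poly u) (trace_poly v) (trace_poly (u @ v))"

text \<open>Both sides give the trace of t at the pair of matrices obtained from u and v. So
  \<open>trace_subst\<close> is the action on C[x, y, z] of the free group endomorphism a -> u, w ->
  v.\<close>

lemma trace_subst_trace_poly: "trace_subst u v (trace_poly t) = trace_poly (word_subst u v t)"
proof (rule poly_xyz_eqI)
  fix A W :: "complex^2^2" assume det: "det A = 1" "det W = 1"
  let ?U = "mat_eval A W u" and ?V = "mat_eval A W v"
  have "trace (mat_eval ?U ?V t) = trace (mat_eval A W (word_subst u v t))"
    using group.word_value_word_subst[OF group_SL2C range_mat_pair[OF det], of u v t] by simp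
  then show "eval_xyz (trace_subst u v (trace_poly t)) (trace A) (trace W) (trace (A ** W)) =
      eval_xyz (trace_poly (word_subst u v t)) (trace A) (trace W) (trace (A ** W))"
    by (simp add: trace_subst_def trace_mat_eval[OF det, symmetric] mat_eval_append[OF det]
        trace_mat_eval[OF det_mat_eval[OF det] det_mat_eval[OF det], symmetric])
qed

context group
begin

text \<open>Preimages of ideals under substitution are ideals, so only generators need checking;
  substitution carries words with equal values to words with equal values.\<close>

lemma trace_subst_trace_ideal:
  assumes "a \<in> carrier G" "w \<in> carrier G"
    and "word_value G (case_letter a w) u = g" "word_value G (case_letter a w) v = h"
    and "p \<in> trace_ideal G g h"
  shows "trace_subst u v p \<in> trace_ideal G a w"
proof -
  let ?I = "{p. trace_subst u v p \<in> trace_ideal G a w}"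
  note J = ideal_ring_xyzD[OF ideal_trace_ideal[of G a w]]
  have range: "range (case_letter a w) \<subseteq> carrier G" using assms(1,2) by (simp add: range_case_letter)
  have "ideal ?I ring_xyz"
    by (rule ideal_ring_xyzI) (simp_all add: trace_subst_def subst_xyz_simps J)
  moreover have "trace_relations G g h \<subseteq> ?I"
  proof
    fix p assume "p \<in> trace_relations G g h"
    then obtain s t where st: "p = trace_poly s - trace_poly t"
      "word_value G (case_letter g h) s = word_value G (case_letter g h) t"
      by (auto simp: trace_relations_def)
    then have "word_value G (case_letter a w) (word_subst u v s) = word_value G (case_letter a w) (word_subst u v t)"
      by (simp add: word_value_word_subst[OF range] assms(3,4))
    then have "trace_poly (word_subst u v s) - trace_poly (word_subst u v t) \<in> trace_relations G a w"
      by (auto simp: trace_relations_def)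
    moreover have "trace_subst u v p = trace_poly (word_subst u v s) - trace_poly (word_subst u v t)"
      unfolding st(1) trace_subst_trace_poly[symmetric] by (simp add: trace_subst_def subst_xyz_simps)
    ultimately show "p \<in> ?I" using subsetD[OF trace_relations_subset[of G a w]] by simp
  qed
  ultimately have "trace_ideal G g h \<subseteq> ?I" by (rule trace_ideal_minimal)
  with assms(5) show ?thesis by blast
qed

text \<open>The composed words have the same values in the group as the letters, so the composite
  fixes x, y, z modulo the ideal, and therefore every polynomial.\<close>

lemma trace_subst_inverse:
  assumes gh: "g \<in> carrier G" "h \<in> carrier G"
    and "word_value G (case_letter a w) u = g" "word_value G (case_letter a w) v = h"
    and "word_value G (case_letter g h) u' = a" "word_value G (case_letter g h) v' = w"
  shows "trace_subst u' v' (trace_subst u v p) - p \<in> trace_ideal G g h"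
proof -
  note J = ideal_ring_xyzD[OF ideal_trace_ideal[of G g h]]
  have range: "range (case_letter g h) \<subseteq> carrier G" using gh by (simp add: range_case_letter)
  have aw: "a \<in> carrier G" "w \<in> carrier G" using assms(5,6) range word_value_closed by blast+
  then have range': "range (case_letter a w) \<subseteq> carrier G" by (simp add: range_case_letter)
  have rel: "trace_poly (word_subst u' v' s) - trace_poly t \<in> trace_ideal G g h"
    if "word_value G (case_letter a w) s = word_value G (case_letter g h) t" for s t
    using that trace_relations_subset[of G g h]
    by (force simp: trace_relations_def word_value_word_subst[OF range] assms(5,6))
  show ?thesis
  proof (induction p rule: poly_xyz_induct)
    case (const c)
    show ?case by (simp add: trace_subst_def subst_xyz_simps J)
  next
    case x
    have "trace_subst u v var_x = trace_poly u" by (simp add: trace_subst_def subst_xyz_simps)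
    then show ?case using rel[of u letter_a] gh by (simp add: trace_subst_trace_poly assms(3))
  next
    case y
    have "trace_subst u v var_y = trace_poly v" by (simp add: trace_subst_def subst_xyz_simps)
    then show ?case using rel[of v letter_w] gh by (simp add: trace_subst_trace_poly assms(4))
  next
    case z
    have "trace_subst u v var_z = trace_poly (u @ v)" by (simp add: trace_subst_def subst_xyz_simps)
    moreover have "trace_poly [(A_letter, True), (W_letter, True)] = var_z"
      using trace_poly_generators(4) by simp
    ultimately show ?case
      using rel[of "u @ v" "letter_a @ letter_w"] gh
      by (simp add: trace_subst_trace_poly assms(3,4) word_value_append[OF range'])
  next
    case (add p q)
    from J(2)[OF add] show ?case by (simp add: trace_subst_def subst_xyz_simps algebra_simps)
  next
    case (mult p q)
    let ?T = "\<lambda>p. trace_subst u' v' (trace_subst u v p)"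
    \<comment> \<open>The telescoping form of the difference between \<open>?T p * ?T q\<close> and
      p q.\<close>
    have "?T p * (?T q - q) + q * (?T p - p) \<in> trace_ideal G g h"
      using mult J by blast
    moreover have "?T (p * q) = ?T p * ?T q" by (simp add: trace_subst_def subst_xyz_simps)
    ultimately show ?case by (simp add: algebra_simps)
  qed
qed

text \<open>Substitution of words gives mutually inverse homomorphisms between the two quotient rings.\<close>

lemma trace_ideal_radical_transfer:
  assumes gen: "generating_pair G a w" "generating_pair G g h"
    and rad: "\<And>p k. p ^ k \<in> trace_ideal G a w \<Longrightarrow> p \<in> trace_ideal G a w"
    and "p ^ k \<in> trace_ideal G g h"
  shows "p \<in> trace_ideal G g h"
proof -
  have c: "a \<in> carrier G" "w \<in> carrier G" "g \<in> carrier G" "h \<in> carrier G"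
    using gen by (auto simp: generating_pair_def)
  obtain u v where uv: "word_value G (case_letter a w) u = g" "word_value G (case_letter a w) v = h"
    using generating_pair_word[OF gen(1)] c by meson
  obtain u' v' where uv': "word_value G (case_letter g h) u' = a" "word_value G (case_letter g h) v' = w"
    using generating_pair_word[OF gen(2)] c by meson
  have "trace_subst u v p ^ k \<in> trace_ideal G a w"
    using trace_subst_trace_ideal[OF c(1,2) uv assms(4)] by (simp add: trace_subst_def subst_xyz_simps)
  then have "trace_subst u v p \<in> trace_ideal G a w" by (rule rad)
  then have 1: "trace_subst u' v' (trace_subst u v p) \<in> trace_ideal G g h"
    using trace_subst_trace_ideal[OF c(3,4) uv'] by blast
  from ideal_ring_xyzD(4)[OF ideal_trace_ideal 1 trace_subst_inverse[OF c(3,4) uv uv', of p]]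
  show ?thesis by simp
qed

end

theorem theorem2:
  fixes m n :: int
  shows
    "let L = pretzel_link_group (-2) (2 * m + 1) (2 * n);
         a = pretzel_meridian_a (-2) (2 * m + 1) (2 * n);
         \<alpha> = trace_poly (word_u m);
         \<beta> = trace_poly (letter_a @ letter_w @ letter_a @ inv_word letter_w);
         f = trace_poly (word_r m n @ letter_a @ letter_w)
             - trace_poly (rev (word_r m n) @ letter_a @ letter_w)
     in
       (\<exists>\<phi> \<in> iso L (two_generator_group m n).
          \<phi> a = word_class (two_generator_relations m n) letter_a \<and>
          (\<exists>w \<in> carrier L.
             \<phi> w = word_class (two_generator_relations m n) letter_w \<and>
             generating_pair L a w \<and>
             universal_character_ring L a w = ring_xyz Quot (PIdl\<^bsub>ring_xyz\<^esub> f))) \<and>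
       \<beta> = var_x * var_y * var_z + 2 - var_y ^ 2 - var_z ^ 2 \<and>
       \<alpha> = var_y * cheb (m - 1) \<beta> - (var_x * var_z - var_y) * cheb (m - 2) \<beta> \<and>
       f = (var_x * var_y * var_z + 4 - var_x ^ 2 - var_y ^ 2 - var_z ^ 2) *
             ((var_x * var_z - var_y) * cheb (n - 1) \<alpha> - (cheb m \<beta> - cheb (m - 1) \<beta>) * cheb (n - 2) \<alpha>) \<and>
       (\<forall>g h. generating_pair L g h \<longrightarrow> reduced_ring (universal_character_ring L g h))"
proof -
  let ?L = "pretzel_link_group (-2) (2 * m + 1) (2 * n)"
  let ?a = "pretzel_meridian_a (-2) (2 * m + 1) (2 * n)"
  let ?R = "two_generator_relations m n"
  let ?T = "two_generator_group m n"
  let ?f = "defining_poly m n"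
  interpret L: group ?L unfolding pretzel_link_group_def by (rule presented_group_is_group)
  interpret T: group ?T unfolding two_generator_group_def by (rule presented_group_is_group)
  obtain \<phi> w where \<phi>: "\<phi> \<in> iso ?L ?T" "\<phi> ?a = word_class ?R letter_a"
    "w \<in> carrier ?L" "\<phi> w = word_class ?R letter_w"
    by (rule pretzel_link_group_iso)
  have a: "?a \<in> carrier ?L"
    by (simp add: pretzel_link_group_def pretzel_meridian_a_def)
  have hom: "\<phi> \<in> hom ?L ?T" and bij: "bij_betw \<phi> (carrier ?L) (carrier ?T)"
    using \<phi>(1) by (auto simp: iso_def)
  have range: "range (case_letter ?a w) \<subseteq> carrier ?L" using a \<phi>(3) by (simp add: range_case_letter)
  \<comment> \<open>Values of words at the chosen pair correspond to word classes, so equality of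
    such values in the link group is \<open>word_eq\<close> for the relation r = reversed r.\<close>
  have val: "\<phi> (word_value ?L (case_letter ?a w) u) = word_class ?R u" for u
  proof -
    have "(\<lambda>l. \<phi> (case_letter ?a w l)) = (\<lambda>l. word_class ?R [(l, True)])"
      by (auto simp: \<phi> split: letter.splits)
    then show ?thesis
      using L.word_value_eq_hom[OF hom T.is_group range, of u] word_value_presented_group[of ?R u]
      by (simp add: two_generator_group_def)
  qed
  have gen: "generating_pair ?L ?a w"
  proof (rule L.generating_pairI[OF a \<phi>(3)])
    fix s assume s: "s \<in> carrier ?L"
    then have "\<phi> s \<in> carrier ?T" using hom by (auto simp: hom_def)
    then obtain u where "\<phi> s = word_class ?R u"
      by (auto simp: two_generator_group_def presented_group_def)
    then have "s = word_value ?L (case_letter ?a w) u"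
      using val[of u] s range L.word_value_closed bij by (metis bij_betw_def inj_onD)
    then show "\<exists>u. s = word_value ?L (case_letter ?a w) u" ..
  qed
  have eq_iff: "word_value ?L (case_letter ?a w) u = word_value ?L (case_letter ?a w) v \<longleftrightarrow> word_eq ?R u v" for u v
    using val[of u] val[of v] range L.word_value_closed bij
    by (metis bij_betw_def inj_onD word_class_eq_iff)
  \<comment> \<open>The polynomial f comes from a pair of equal words itself, and
    \<open>defining_poly_dvd\<close> shows that it divides every other trace relation.\<close>
  have ideal: "trace_ideal ?L ?a w = PIdl\<^bsub>ring_xyz\<^esub> ?f"
  proof (rule trace_ideal_eq_cgenideal)
    have "word_eq ?R (word_r m n @ letter_a @ letter_w) (rev (word_r m n) @ letter_a @ letter_w)"
      by (intro word_eq_append word_eq_refl word_eq_rel) (simp add: two_generator_relations_def)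
    then show "?f \<in> trace_relations ?L ?a w"
      unfolding trace_relations_def eq_iff defining_poly_def by blast
    show "?f dvd p" if "p \<in> trace_relations ?L ?a w" for p
      using that unfolding trace_relations_def eq_iff by (auto intro: defining_poly_dvd)
  qed
  have rad: "p \<in> trace_ideal ?L ?a w" if "p ^ k \<in> trace_ideal ?L ?a w" for p k
    using that product_dvd_power_imp_dvd[of m n p k]
    unfolding ideal cgenideal_ring_xyz defining_poly_eq by blast
  \<comment> \<open>Radicality, known for the pair with the explicit generator f, passes to any
    generating pair by substitution of words.\<close>
  have "reduced_ring (universal_character_ring ?L g h)" if "generating_pair ?L g h" for g h
    unfolding universal_character_ring_def
    by (rule reduced_ring_Quot[OF ideal_trace_ideal L.trace_ideal_radical_transfer[OF gen that rad]])
  moreover have "universal_character_ring ?L ?a w = ring_xyz Quot (PIdl\<^bsub>ring_xyz\<^esub> ?f)"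
    by (simp add: universal_character_ring_def ideal)
  ultimately show ?thesis
    using \<phi> gen unfolding Let_def trace_poly_word_u trace_poly_word_B defining_poly_def[symmetric]
    unfolding defining_poly_eq abelian_factor_def nonabelian_factor_def tr_u_def tr_awa_def tr_B_def
    by blast
qed

end
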